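(* Let $0<p<\gamma<1$ and $\varepsilon>0$ be fixed, and define \[ \alpha(\gamma,p):=\gamma\log\frac{\gamma}{p}+(1-\gamma)\log\frac{1-\gamma}{1-p}. \] Then, with probability tending to $1$ as $n\to\infty$, \[ \omega_\gamma(G_{n,p})-\frac{2}{\alpha(\gamma,p)}\Big(\log n-\log\log n+\log\frac{e\,\alpha(\gamma,p)}{2}\Big)\in(-\varepsilon,1+\varepsilon). \] In particular, with probability tending to $1$ as $n\to\infty$, $\omega_\gamma(G_{n,p})$ is one of the two integers closest to \[ \frac{2}{\alpha(\gamma,p)}\Big(\log n-\log\log n+\log\frac{e\,\alpha(\gamma,p)}{2}\Big)+\frac{1}{2}. \]
   Context: $G_{n,p}$ denotes the binomial random graph on vertex set $\{1,\dots,n\}$ in which each pair is an edge independently with probability $p$. For $\gamma\in[0,1]$, a graph on $m$ vertices is a $\gamma$-quasi-clique if it has at least $\gamma\binom{m}{2}$ edges, and $\omega_\gamma(G)$ is the largest integer $k$ such that $G$ has a $k$-vertex subgraph that is a $\gamma$-quasi-clique. Logarithms are natural. *)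

theory Defs
  imports "HOL-Probability.Probability"
begin

type_synonym 'a graph = "'a set \<times> 'a set set"

abbreviation verts :: "'a graph \<Rightarrow> 'a set" where
  "verts G \<equiv> fst G"

abbreviation edges :: "'a graph \<Rightarrow> 'a set set" where
  "edges G \<equiv> snd G"

definition all_pairs :: "'a set \<Rightarrow> 'a set set" where
  "all_pairs V = {e. e \<subseteq> V \<and> card e = 2}"

definition simple_graph :: "'a graph \<Rightarrow> bool" where
  "simple_graph G \<longleftrightarrow> finite (verts G) \<and> edges G \<subseteq> all_pairs (verts G)"

text \<open>Subgraphs are not required to be induced.\<close>

definition subgraph :: "'a graph \<Rightarrow> 'a graph \<Rightarrow> bool" where
  "subgraph H G \<longleftrightarrow> simple_graph H \<and> verts H \<subseteq> verts G \<and> edges H \<subseteq> edges G"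

definition quasi_clique :: "real \<Rightarrow> 'a graph \<Rightarrow> bool" where
  "quasi_clique \<gamma> H \<longleftrightarrow> real (card (edges H)) \<ge> \<gamma> * real (card (verts H) choose 2)"

text \<open>For a finite graph the set below is finite, and it contains \<open>0\<close> because of the empty
  subgraph, so the maximum is meaningful.\<close>

definition quasi_clique_number :: "real \<Rightarrow> 'a graph \<Rightarrow> nat" where
  "quasi_clique_number \<gamma> G =
     Max {k. \<exists>H. subgraph H G \<and> card (verts H) = k \<and> quasi_clique \<gamma> H}"

definition random_graph :: "nat \<Rightarrow> real \<Rightarrow> nat graph pmf" where
  "random_graph n p =
     map_pmf (\<lambda>f. ({1..n}, {e \<in> all_pairs {1..n}. f e}))
       (Pi_pmf (all_pairs {1..n}) False (\<lambda>_. bernoulli_pmf p))"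

definition alpha :: "real \<Rightarrow> real \<Rightarrow> real" where
  "alpha \<gamma> p = \<gamma> * ln (\<gamma> / p) + (1 - \<gamma>) * ln ((1 - \<gamma>) / (1 - p))"

definition quasi_clique_location :: "real \<Rightarrow> real \<Rightarrow> nat \<Rightarrow> real" where
  "quasi_clique_location \<gamma> p n =
     2 / alpha \<gamma> p * (ln (real n) - ln (ln (real n)) + ln (exp 1 * alpha \<gamma> p / 2))"

text \<open>If \<open>y\<close> is an integer, then \<open>y - 1\<close> and \<open>y + 1\<close> are tied for second place, and both
  \<open>{y - 1, y}\<close> and \<open>{y, y + 1}\<close> satisfy the following predicate; otherwise exactly one set does.\<close>

definition two_closest_integers :: "int set \<Rightarrow> real \<Rightarrow> bool" where
  "two_closest_integers S y \<longleftrightarrow>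
     card S = 2 \<and> (\<forall>i\<in>S. \<forall>j. j \<notin> S \<longrightarrow> \<bar>of_int i - y\<bar> \<le> \<bar>of_int j - y\<bar>)"

lemma two_closest_integers_floor: "two_closest_integers {\<lfloor>y\<rfloor>, \<lfloor>y\<rfloor> + 1} y"
proof -
  have "\<bar>of_int i - y\<bar> \<le> \<bar>of_int j - y\<bar>"
    if "i \<in> {\<lfloor>y\<rfloor>, \<lfloor>y\<rfloor> + 1}" "j \<notin> {\<lfloor>y\<rfloor>, \<lfloor>y\<rfloor> + 1}" for i j
  proof -
    from that have "j \<le> \<lfloor>y\<rfloor> - 1 \<or> j \<ge> \<lfloor>y\<rfloor> + 2" by auto
    then have "real_of_int j \<le> of_int \<lfloor>y\<rfloor> - 1 \<or> real_of_int j \<ge> of_int \<lfloor>y\<rfloor> + 2"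
      by linarith
    then have "1 \<le> \<bar>of_int j - y\<bar>" by linarith
    moreover have "\<bar>of_int i - y\<bar> \<le> 1"
      using that(1) by (elim insertE; simp; linarith)
    ultimately show ?thesis by linarith
  qed
  then show ?thesis unfolding two_closest_integers_def by auto
qed

end

theory Submission imports Defs "HOL-Real_Asymp.Real_Asymp" begin

text \<open>Write \<open>L\<close> for the location and \<open>N = k choose 2\<close>. A \<open>k\<close>-set of vertices spans at least
  \<open>\<gamma> N\<close> edges with probability at most \<open>exp (- \<alpha> N)\<close> (Chernoff), and a union bound over all
  sets with at least \<open>L + 1 + \<epsilon>\<close> vertices gives the upper bound.

  For the lower bound take \<open>k\<close> with \<open>L - \<epsilon> < k \<le> L - \<epsilon> + 1\<close>. The plain second moment of the number of
  quasi-cliques can be too large, because two of them with a large overlap prefer a denser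
  overlap. One therefore counts only \<^emph>\<open>balanced\<close> sets: exactly \<open>\<lceil>\<gamma> N\<rceil>\<close> edges, and at most
  about a \<open>\<gamma>\<close>-fraction of the pairs inside any subset, up to an error that shrinks linearly as
  the subset approaches the whole set. Conditioned on its number of edges, the graph on the set does
  not depend on the edge probability, so it may be sampled with edge probability \<open>\<gamma>\<close>; Hoeffding's
  inequality then shows that the restriction costs only a polynomial factor. For balanced sets
  with overlap \<open>l\<close>, the second one contributes at most \<open>exp (- \<alpha> (N - (l choose 2)) + error)\<close>,
  which suffices for Chebyshev's inequality.

  The second claim is the first one with \<open>\<epsilon> = 1 / 4\<close>.\<close>

subsection \<open>Random subsets\<close>

text \<open>The ground set is arbitrary so that the pairs inside a vertex set, or inside one set but
  not another, can be treated in the same way as all pairs.\<close>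

definition random_subset :: "'a set \<Rightarrow> real \<Rightarrow> 'a set pmf" where
  "random_subset E p = map_pmf (\<lambda>f. {x \<in> E. f x}) (Pi_pmf E False (\<lambda>_. bernoulli_pmf p))"

lemma set_pmf_random_subset: "set_pmf (random_subset E p) \<subseteq> Pow E"
  unfolding random_subset_def by auto

lemma random_graph_eq:
  "random_graph n p = map_pmf (Pair {1..n}) (random_subset (all_pairs {1..n}) p)"
  unfolding random_graph_def random_subset_def by (simp add: map_pmf_comp)

lemma random_subset_Int:
  assumes "finite E" "A \<subseteq> E"
  shows "map_pmf (\<lambda>S. S \<inter> A) (random_subset E p) = random_subset A p"
  unfolding random_subset_def Pi_pmf_subset[OF assms] map_pmf_comp
  by (rule map_pmf_cong) (use assms in auto)

lemma random_subset_Un: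
  assumes "finite A" "finite B" "A \<inter> B = {}"
  shows "random_subset (A \<union> B) p =
    map_pmf (\<lambda>(S, T). S \<union> T) (pair_pmf (random_subset A p) (random_subset B p))"
  unfolding random_subset_def Pi_pmf_union[OF assms] map_pmf_comp map_pair[symmetric]
  by (rule map_pmf_cong) (use assms in auto)

lemma prob_random_subset_Int:
  assumes "finite E" "A \<subseteq> E"
  shows "measure_pmf.prob (random_subset E p) {S. P (S \<inter> A)} =
    measure_pmf.prob (random_subset A p) {S. P S}"
  unfolding random_subset_Int[OF assms, symmetric] by (simp add: vimage_def)

text \<open>The trace on \<open>A \<union> B\<close> is the union of independent random subsets of
  \<open>A\<close> and of \<open>B\<close>, so events that look only at disjoint parts are
  independent.\<close>

lemma prob_random_subset_indep:
  assumes "finite E" "A \<subseteq> E" "B \<subseteq> E" "A \<inter> B = {}"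
  shows "measure_pmf.prob (random_subset E p) {S. P (S \<inter> A) \<and> Q (S \<inter> B)} =
    measure_pmf.prob (random_subset E p) {S. P (S \<inter> A)} *
    measure_pmf.prob (random_subset E p) {S. Q (S \<inter> B)}"
proof -
  have fin: "finite A" "finite B" using assms by (auto intro: finite_subset)
  let ?q = "pair_pmf (random_subset A p) (random_subset B p)"
  have "measure_pmf.prob (random_subset E p) {S. P (S \<inter> A) \<and> Q (S \<inter> B)} =
    measure_pmf.prob (random_subset (A \<union> B) p) {S. P (S \<inter> A) \<and> Q (S \<inter> B)}"
    using prob_random_subset_Int[of E "A \<union> B" p "\<lambda>S. P (S \<inter> A) \<and> Q (S \<inter> B)"] assms
    by (simp add: Int_assoc Int_absorb1)
  also have "\<dots> = measure_pmf.prob ?q {x. P ((fst x \<union> snd x) \<inter> A) \<and> Q ((fst x \<union> snd x) \<inter> B)}"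
    unfolding random_subset_Un[OF fin assms(4)] by (simp add: vimage_def case_prod_unfold)
  \<comment> \<open>Intersecting with \<open>Pow A\<close> and \<open>Pow B\<close> removes only
    null sets and makes both factors finite, so that the product rule for countable sets
    applies.\<close>
  also have "\<dots> = measure_pmf.prob ?q (({S. P S} \<inter> Pow A) \<times> ({S. Q S} \<inter> Pow B))"
  proof (rule measure_pmf.finite_measure_eq_AE, rule AE_pmfI)
    fix x assume "x \<in> set_pmf ?q"
    then have "fst x \<subseteq> A" "snd x \<subseteq> B"
      using set_pmf_random_subset by fastforce+
    then have "(fst x \<union> snd x) \<inter> A = fst x" "(fst x \<union> snd x) \<inter> B = snd x"
      using assms(4) by auto
    then show "x \<in> {x. P ((fst x \<union> snd x) \<inter> A) \<and> Q ((fst x \<union> snd x) \<inter> B)} \<longleftrightarrow>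
       x \<in> ({S. P S} \<inter> Pow A) \<times> ({S. Q S} \<inter> Pow B)"
      using \<open>fst x \<subseteq> A\<close> \<open>snd x \<subseteq> B\<close> by (cases x) auto
  qed auto
  also have "\<dots> = measure_pmf.prob (random_subset A p) ({S. P S} \<inter> Pow A) *
     measure_pmf.prob (random_subset B p) ({S. Q S} \<inter> Pow B)"
    using fin by (intro measure_pmf_prob_product countable_finite) auto
  also have "measure_pmf.prob (random_subset A p) ({S. P S} \<inter> Pow A) =
     measure_pmf.prob (random_subset A p) {S. P S}"
    using set_pmf_random_subset[of A p] by (intro measure_pmf.finite_measure_eq_AE AE_pmfI) auto
  also have "measure_pmf.prob (random_subset B p) ({S. Q S} \<inter> Pow B) =
     measure_pmf.prob (random_subset B p) {S. Q S}"
    using set_pmf_random_subset[of B p] by (intro measure_pmf.finite_measure_eq_AE AE_pmfI) auto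
  finally show ?thesis
    using assms by (simp add: prob_random_subset_Int)
qed

lemma prob_random_subset_card:
  assumes "finite E" "A \<subseteq> E" "p \<in> {0..1}"
  shows "measure_pmf.prob (random_subset E p) {S. P (card (S \<inter> A))} =
    measure_pmf.prob (binomial_pmf (card A) p) {i. P i}"
proof -
  have A: "finite A" using assms by (auto intro: finite_subset)
  have "map_pmf card (random_subset A p) = binomial_pmf (card A) p"
    unfolding random_subset_def map_pmf_comp
    by (rule binomial_pmf_altdef'[symmetric]) (use A assms in auto)
  then show ?thesis
    unfolding prob_random_subset_Int[OF assms(1,2), where P = "\<lambda>S. P (card S)"]
    by (metis measure_map_pmf vimage_Collect_eq)
qed

lemma pmf_random_subset:
  assumes "finite E" "S \<subseteq> E" "p \<in> {0..1}"
  shows "pmf (random_subset E p) S = p ^ card S * (1 - p) ^ (card E - card S)"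
proof -
  let ?f = "\<lambda>x. x \<in> S"
  let ?\<pi> = "Pi_pmf E False (\<lambda>_. bernoulli_pmf p)"
  have "pmf (random_subset E p) S = measure_pmf.prob ?\<pi> {f. {x \<in> E. f x} = S}"
    unfolding random_subset_def pmf_map by (simp add: vimage_def)
  \<comment> \<open>Outside \<open>E\<close> a sampled function almost surely takes the default
    value \<open>False\<close>, so the subset \<open>S\<close> pins it down completely.\<close>
  also have "\<dots> = measure_pmf.prob ?\<pi> {?f}"
  proof (rule measure_pmf.finite_measure_eq_AE, rule AE_pmfI)
    fix f assume "f \<in> set_pmf ?\<pi>"
    then have "\<forall>x. x \<notin> E \<longrightarrow> \<not> f x"
      using set_Pi_pmf_subset[OF assms(1), of False] by fastforce
    then show "f \<in> {f. {x \<in> E. f x} = S} \<longleftrightarrow> f \<in> {?f}"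
      using assms by (auto simp: fun_eq_iff)
  qed auto
  also have "\<dots> = (\<Prod>x\<in>E. pmf (bernoulli_pmf p) (?f x))"
    using assms by (subst measure_pmf_single, subst pmf_Pi') auto
  also have "\<dots> = (\<Prod>x\<in>E. if x \<in> S then p else 1 - p)"
    using assms by (intro prod.cong) auto
  also have "\<dots> = p ^ card S * (1 - p) ^ card (E - S)"
    using assms by (simp add: prod.If_cases Int_absorb1 Diff_eq)
  finally show ?thesis
    using assms by (simp add: card_Diff_subset finite_subset)
qed

text \<open>Change of measure: all sets of size \<open>m\<close> have the same ratio of
  probabilities, so it comes out of the sum whatever \<open>P\<close> is. Later \<open>q\<close> is
  \<gamma>, for which a size close to \<gamma> times the number of pairs is typical.\<close>

lemma prob_random_subset_change:
  assumes "finite E" "p \<in> {0..1}" "q \<in> {0<..<1}" "m \<le> card E"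
  shows "measure_pmf.prob (random_subset E p) {S. card S = m \<and> P S} =
    (p / q) ^ m * ((1 - p) / (1 - q)) ^ (card E - m) *
    measure_pmf.prob (random_subset E q) {S. card S = m \<and> P S}"
proof -
  let ?X = "{S. S \<subseteq> E \<and> card S = m \<and> P S}"
  have *: "measure_pmf.prob (random_subset E r) {S. card S = m \<and> P S} =
      (\<Sum>S\<in>?X. pmf (random_subset E r) S)" for r
  proof -
    have "measure_pmf.prob (random_subset E r) {S. card S = m \<and> P S} =
      measure_pmf.prob (random_subset E r) ?X"
      using set_pmf_random_subset[of E r] by (intro measure_pmf.finite_measure_eq_AE AE_pmfI) auto
    then show ?thesis
      using assms(1) by (simp add: measure_measure_pmf_finite)
  qed
  show ?thesis
    unfolding * sum_distrib_left
  proof (rule sum.cong)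
    fix S assume "S \<in> ?X"
    then have S: "S \<subseteq> E" "card S = m" by auto
    show "pmf (random_subset E p) S = (p / q) ^ m * ((1 - p) / (1 - q)) ^ (card E - m) *
       pmf (random_subset E q) S"
      using assms S by (simp add: pmf_random_subset power_divide)
  qed simp
qed

section \<open>Tail and central term of the binomial distribution\<close>

text \<open>Chernoff's bound with slack: the base that is optimal for \<open>s = 0\<close> is kept
  for all \<open>s\<close>, so a lower threshold costs only a term linear in \<open>s\<close> in the
  exponent.\<close>

lemma binomial_tail_exp_le:
  fixes p \<gamma> s :: real
  assumes "0 < p" "p < \<gamma>" "\<gamma> < 1"
  shows "measure_pmf.prob (binomial_pmf N p) {i. \<gamma> * N - s \<le> real i} \<le>
     exp (- alpha \<gamma> p * N + ln (\<gamma> * (1 - p) / (p * (1 - \<gamma>))) * s)"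
proof -
  \<comment> \<open>Weighting each success by \<open>u\<close> moves the mean to
    \<open>\<gamma> * N\<close>, since \<open>p * u / (p * u + 1 - p) = \<gamma>\<close>.\<close>
  define u where "u = \<gamma> * (1 - p) / (p * (1 - \<gamma>))"
  have "p * (1 - \<gamma>) < \<gamma> * (1 - p)" using assms by (simp add: algebra_simps)
  then have u: "u > 1" using assms by (simp add: u_def)
  have al: "alpha \<gamma> p = \<gamma> * ln u + ln ((1 - \<gamma>) / (1 - p))"
    using assms by (simp add: alpha_def u_def ln_div ln_mult) (simp add: algebra_simps)
  have "measure_pmf.prob (binomial_pmf N p) {i. \<gamma> * N - s \<le> real i} =
     measure_pmf.prob (binomial_pmf N p) {i. i \<le> N \<and> \<gamma> * N - s \<le> real i}"
    using assms by (intro measure_pmf.finite_measure_eq_AE AE_pmfI) auto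
  also have "\<dots> = (\<Sum>i | i \<le> N \<and> \<gamma> * N - s \<le> real i. pmf (binomial_pmf N p) i)"
    by (subst measure_measure_pmf_finite) auto
  also have "\<dots> \<le> (\<Sum>i | i \<le> N \<and> \<gamma> * N - s \<le> real i.
      real (N choose i) * (p * u) ^ i * (1 - p) ^ (N - i) * u powr (s - \<gamma> * N))"
  proof (rule sum_mono)
    fix i assume "i \<in> {i. i \<le> N \<and> \<gamma> * N - s \<le> real i}"
    \<comment> \<open>Inserting a factor that is at least 1 on the event is Markov's inequality for
      \<open>u ^ i\<close>.\<close>
    then have "1 \<le> u powr (i + (s - \<gamma> * N))"
      using u by (intro ge_one_powr_ge_zero) auto
    also have "\<dots> = u ^ i * u powr (s - \<gamma> * N)"
      using u by (simp add: powr_add powr_realpow)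
    finally have "1 \<le> u ^ i * u powr (s - \<gamma> * N)" .
    then have "real (N choose i) * p ^ i * (1 - p) ^ (N - i) * 1 \<le>
      real (N choose i) * p ^ i * (1 - p) ^ (N - i) * (u ^ i * u powr (s - \<gamma> * N))"
      using assms by (intro mult_left_mono) auto
    then show "pmf (binomial_pmf N p) i \<le>
      real (N choose i) * (p * u) ^ i * (1 - p) ^ (N - i) * u powr (s - \<gamma> * N)"
      using assms by (simp add: power_mult_distrib mult_ac)
  qed
  also have "\<dots> \<le> (\<Sum>i\<le>N. real (N choose i) * (p * u) ^ i * (1 - p) ^ (N - i) * u powr (s - \<gamma> * N))"
    using assms u by (intro sum_mono2) auto
  also have "\<dots> = (p * u + (1 - p)) ^ N * u powr (s - \<gamma> * N)"
    by (simp add: binomial_ring sum_distrib_right)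
  also have "p * u + (1 - p) = (1 - p) / (1 - \<gamma>)"
    using assms by (simp add: u_def field_simps)
  also have "((1 - p) / (1 - \<gamma>)) ^ N = exp (- ln ((1 - \<gamma>) / (1 - p)) * N)"
    using assms exp_of_nat2_mult[of "ln ((1 - p) / (1 - \<gamma>))" N] by (simp add: ln_div exp_diff)
  also have "u powr (s - \<gamma> * N) = exp (ln u * (s - \<gamma> * N))"
    using u by (simp add: powr_def mult.commute)
  also have "exp (- ln ((1 - \<gamma>) / (1 - p)) * N) * exp (ln u * (s - \<gamma> * N)) =
      exp (- alpha \<gamma> p * N + ln u * s)"
    unfolding al by (simp add: algebra_simps flip: exp_add)
  finally show ?thesis unfolding u_def .
qed

lemma binomial_pmf_Suc:
  assumes "\<gamma> \<in> {0..1}" "i < N"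
  shows "pmf (binomial_pmf N \<gamma>) (Suc i) * (real (Suc i) * (1 - \<gamma>)) =
    pmf (binomial_pmf N \<gamma>) i * ((real N - real i) * \<gamma>)"
proof -
  have "Suc i * (N choose Suc i) = (N - i) * (N choose i)"
    by (simp only: binomial_absorption binomial_absorb_comp)
  then have "real (Suc i) * real (N choose Suc i) = (real N - real i) * real (N choose i)"
    using assms(2) by (metis of_nat_mult of_nat_diff less_imp_le)
  moreover have "(1 - \<gamma>) ^ (N - i) = (1 - \<gamma>) * (1 - \<gamma>) ^ (N - Suc i)"
    using assms(2) by (metis Suc_diff_Suc power_Suc)
  ultimately show ?thesis
    using assms by (simp del: of_nat_Suc binomial_Suc_Suc add: mult_ac)
qed

text \<open>By the ratio of consecutive terms, the terms rise up to \<open>m - 1\<close> and fall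
  from \<open>m\<close> on, and the step between loses at most a factor 2. Hence each of the
  \<open>N + 1\<close> terms is at most twice the one at \<open>m\<close>, and they sum to
  1.\<close>

lemma pmf_binomial_ceiling_ge:
  assumes "\<gamma> \<in> {0<..<1}" "1 \<le> \<gamma> * real N"
  defines "m \<equiv> nat \<lceil>\<gamma> * real N\<rceil>"
  shows "1 / (2 * (real N + 1)) \<le> pmf (binomial_pmf N \<gamma>) m"
proof -
  define b where "b = pmf (binomial_pmf N \<gamma>)"
  have rec: "b (Suc i) * (real (Suc i) * (1 - \<gamma>)) = b i * ((real N - real i) * \<gamma>)" if "i < N" for i
    unfolding b_def using assms(1) that by (intro binomial_pmf_Suc) auto
  have nonneg: "0 \<le> b i" for i by (simp add: b_def)
  have m: "\<gamma> * real N \<le> real m" "real m < \<gamma> * real N + 1"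
    using assms unfolding m_def by (auto; linarith)+
  have "m > 0" using m(1) assms(2) by (cases m) auto
  have up: "b (Suc i) \<le> b i" if "m \<le> i" "i < N" for i
  proof -
    have "real N * \<gamma> \<le> real i" using that(1) m by (simp add: mult.commute)
    then have "(real N - real i) * \<gamma> \<le> real (Suc i) * (1 - \<gamma>)"
      using assms(1) by (simp add: algebra_simps)
    then have "b i * ((real N - real i) * \<gamma>) \<le> b i * (real (Suc i) * (1 - \<gamma>))"
      by (intro mult_left_mono nonneg)
    then have "b (Suc i) * (real (Suc i) * (1 - \<gamma>)) \<le> b i * (real (Suc i) * (1 - \<gamma>))"
      using rec[of i] that(2) assms(1) by simp
    then show ?thesis using assms(1) by (simp del: of_nat_Suc)
  qed
  have down: "b i \<le> b (Suc i)" if "Suc i < m" for i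
  proof -
    have i: "real (Suc i) \<le> \<gamma> * real N" using that m by linarith
    also have "\<dots> \<le> 1 * real N" using assms(1) by (intro mult_right_mono) auto
    finally have "i < N" by simp
    have "real (Suc i) * (1 - \<gamma>) \<le> (real N - real i) * \<gamma>"
      using i assms(1) by (simp add: algebra_simps)
    then have "b i * (real (Suc i) * (1 - \<gamma>)) \<le> b i * ((real N - real i) * \<gamma>)"
      by (intro mult_left_mono nonneg)
    then have "b i * (real (Suc i) * (1 - \<gamma>)) \<le> b (Suc i) * (real (Suc i) * (1 - \<gamma>))"
      using rec[of i] \<open>i < N\<close> assms(1) by simp
    then show ?thesis using assms(1) by (simp del: of_nat_Suc)
  qed
  \<comment> \<open>Rounding up may step past the mode by one; \<open>1 \<le> \<gamma> * N\<close>
    gives \<open>m \<le> 2 * (\<gamma> * N)\<close>, which bounds the loss.\<close>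
  have last: "b (m - 1) \<le> 2 * b m"
  proof -
    have "real m < real N + 1" using m assms(1) mult_right_mono[of \<gamma> 1 "real N"] by auto
    then have lt: "m - 1 < N" using \<open>m > 0\<close> by linarith
    have m1: "real (m - 1) = real m - 1" using \<open>m > 0\<close> by (simp add: of_nat_diff)
    have "real m * (1 - \<gamma>) \<le> 2 * ((real N - real (m - 1)) * \<gamma>)"
    proof -
      have "real m * (1 - \<gamma>) \<le> (2 * (\<gamma> * real N)) * (1 - \<gamma>)"
        using m assms by (intro mult_right_mono) auto
      also have "\<dots> = 2 * ((real N - \<gamma> * real N) * \<gamma>)" by (simp add: algebra_simps)
      also have "\<dots> \<le> 2 * ((real N - real (m - 1)) * \<gamma>)"
        using m assms(1) m1 by (intro mult_left_mono mult_right_mono) auto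
      finally show ?thesis .
    qed
    then have "b (m - 1) * (real m * (1 - \<gamma>)) \<le> b (m - 1) * (2 * ((real N - real (m - 1)) * \<gamma>))"
      by (intro mult_left_mono nonneg)
    also have "\<dots> = 2 * b m * (real m * (1 - \<gamma>))"
      using rec[of "m - 1"] lt assms(1) \<open>m > 0\<close> by simp
    finally show ?thesis using assms(1) \<open>m > 0\<close> by simp
  qed
  have bound: "b i \<le> 2 * b m" if "i \<le> N" for i
  proof (cases "m \<le> i")
    case True
    then have "b i \<le> b m"
      using that
    proof (induction i rule: dec_induct)
      case (step j)
      then show ?case using up[of j] by simp
    qed simp
    then show ?thesis using nonneg[of m] by linarith
  next
    case False
    then have "i \<le> m - 1" by simp
    then have "b i \<le> b (m - 1)"
    proof (induction i rule: inc_induct)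
      case (step j)
      then show ?case using down[of j] by linarith
    qed simp
    then show ?thesis using last by linarith
  qed
  have "1 = (\<Sum>i\<le>N. b i)"
    unfolding b_def using assms(1) by (subst sum_pmf_eq_1) auto
  also have "\<dots> \<le> (\<Sum>i\<le>N. 2 * b m)" using bound by (intro sum_mono) auto
  also have "\<dots> = 2 * (real N + 1) * b m" by simp
  finally have "1 \<le> 2 * (real N + 1) * b m" .
  then show ?thesis unfolding b_def[symmetric] by (simp add: divide_simps mult.commute)
qed

section \<open>Chebyshev's inequality for counting events\<close>

text \<open>If none of the events occurs, the number \<open>X\<close> of occurring events is 0 and
  \<open>(X - m)^2 = m^2\<close>, so the left side is at most the variance of
  \<open>X\<close>.\<close>

lemma (in prob_space) second_moment_prob_zero:
  assumes "finite I" "\<And>i. i \<in> I \<Longrightarrow> F i \<in> events"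
  shows "prob {x \<in> space M. \<forall>i\<in>I. x \<notin> F i} * (\<Sum>i\<in>I. prob (F i))\<^sup>2 \<le>
    (\<Sum>i\<in>I. \<Sum>j\<in>I. prob (F i \<inter> F j) - prob (F i) * prob (F j))"
proof -
  define X where "X = (\<lambda>x. \<Sum>i\<in>I. indicat_real (F i) x)"
  define m where "m = (\<Sum>i\<in>I. prob (F i))"
  let ?Z = "{x \<in> space M. \<forall>i\<in>I. x \<notin> F i}"
  have Zm: "?Z \<in> events"
  proof -
    have "?Z = space M - (\<Union>i\<in>I. F i)" by auto
    then show ?thesis using assms by (simp add: sets.finite_UN sets.compl_sets)
  qed
  have int: "integrable M (indicat_real (F i))" if "i \<in> I" for i
    using assms(2)[OF that] by (intro integrable_real_indicator) (auto simp: less_top[symmetric])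
  have int2: "integrable M (indicat_real (F i \<inter> F j))" if "i \<in> I" "j \<in> I" for i j
    using assms(2) that
    by (intro integrable_real_indicator sets.Int) (auto simp: less_top[symmetric])
  have sq: "(X x - m)\<^sup>2 = (\<Sum>i\<in>I. \<Sum>j\<in>I. indicat_real (F i \<inter> F j) x) - 2 * m * X x + m\<^sup>2" for x
    unfolding X_def power2_diff by (simp add: power2_eq_square sum_product indicator_inter_arith)
  have intX: "integrable M X" unfolding X_def using int by simp
  have intSS: "integrable M (\<lambda>x. \<Sum>i\<in>I. \<Sum>j\<in>I. indicat_real (F i \<inter> F j) x)"
    by (intro Bochner_Integration.integrable_sum int2)
  have EX: "expectation X = m"
    unfolding X_def m_def using int assms(2)
    by (subst Bochner_Integration.integral_sum) (auto intro!: sum.cong simp: sets.Int_space_eq2)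
  have "prob ?Z * m\<^sup>2 = expectation (\<lambda>x. indicat_real ?Z x * m\<^sup>2)"
    using Zm by (simp add: Int_absorb1[OF sets.sets_into_space])
  also have "\<dots> \<le> expectation (\<lambda>x. (X x - m)\<^sup>2)"
  proof (rule integral_mono)
    show "integrable M (\<lambda>x. indicat_real ?Z x * m\<^sup>2)"
      using Zm by (intro integrable_mult_left integrable_real_indicator) (auto simp: less_top[symmetric])
    show "integrable M (\<lambda>x. (X x - m)\<^sup>2)" unfolding sq using intX intSS by simp
    show "indicat_real ?Z x * m\<^sup>2 \<le> (X x - m)\<^sup>2" for x
      by (cases "x \<in> ?Z") (auto simp: X_def)
  qed
  also have "\<dots> = expectation (\<lambda>x. \<Sum>i\<in>I. \<Sum>j\<in>I. indicat_real (F i \<inter> F j) x) - 2 * m * m + m\<^sup>2"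
    unfolding sq using intX intSS EX by (simp add: prob_space)
  also have "expectation (\<lambda>x. \<Sum>i\<in>I. \<Sum>j\<in>I. indicat_real (F i \<inter> F j) x) =
      (\<Sum>i\<in>I. \<Sum>j\<in>I. expectation (indicat_real (F i \<inter> F j)))"
    by (subst Bochner_Integration.integral_sum,
        fastforce intro: Bochner_Integration.integrable_sum int2)
      (intro sum.cong refl Bochner_Integration.integral_sum int2)
  also have "\<dots> = (\<Sum>i\<in>I. \<Sum>j\<in>I. prob (F i \<inter> F j))"
    using assms(2) by (intro sum.cong refl) (simp add: sets.Int Int_absorb1[OF sets.sets_into_space])
  also have "\<dots> - 2 * m * m + m\<^sup>2 = (\<Sum>i\<in>I. \<Sum>j\<in>I. prob (F i \<inter> F j) - prob (F i) * prob (F j))"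
    by (simp add: sum_subtractf m_def power2_eq_square sum_product)
  finally show ?thesis unfolding m_def .
qed

subsection \<open>Balanced vertex sets\<close>

lemma finite_all_pairs: "finite V \<Longrightarrow> finite (all_pairs V)"
  unfolding all_pairs_def by (rule finite_subset[of _ "Pow V"]) auto

lemma card_all_pairs: "finite V \<Longrightarrow> card (all_pairs V) = card V choose 2"
  unfolding all_pairs_def by (rule n_subsets)

lemma all_pairs_mono: "A \<subseteq> B \<Longrightarrow> all_pairs A \<subseteq> all_pairs B"
  unfolding all_pairs_def by auto

lemma all_pairs_Int: "all_pairs A \<inter> all_pairs B = all_pairs (A \<inter> B)"
  unfolding all_pairs_def by auto

lemma card_all_pairs_Diff:
  assumes "finite V" "I \<subseteq> V"
  shows "card (all_pairs V - all_pairs I) = (card V choose 2) - (card I choose 2)"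
  using assms
  by (subst card_Diff_subset) (auto simp: finite_all_pairs card_all_pairs all_pairs_mono finite_subset)

lemma choose_two_mono: "m \<le> n \<Longrightarrow> m choose 2 \<le> n choose 2"
  by (simp add: choose_two div_le_mono mult_le_mono diff_le_mono)

lemma real_choose_two: "real (n choose 2) = real n * (real n - 1) / 2"
  by (induction n) (auto simp: numeral_2_eq_2 field_simps)

section \<open>Quasi-cliques in terms of the edges spanned by a vertex set\<close>

lemma le_quasi_clique_number:
  assumes "finite V" "E \<subseteq> all_pairs V" "A \<subseteq> V"
    and "\<gamma> * real (card A choose 2) \<le> real (card (E \<inter> all_pairs A))"
  shows "card A \<le> quasi_clique_number \<gamma> (V, E)"
  unfolding quasi_clique_number_def
proof (rule Max_ge)
  show "finite {k. \<exists>H. subgraph H (V, E) \<and> card (verts H) = k \<and> quasi_clique \<gamma> H}"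
    by (rule finite_subset[of _ "{..card V}"]) (auto simp: subgraph_def assms(1) intro!: card_mono)
  have "subgraph (A, E \<inter> all_pairs A) (V, E)"
    using assms finite_subset by (auto simp: subgraph_def simple_graph_def)
  then show "card A \<in> {k. \<exists>H. subgraph H (V, E) \<and> card (verts H) = k \<and> quasi_clique \<gamma> H}"
    using assms(4) by (force simp: quasi_clique_def)
qed

text \<open>The maximum runs over a finite set containing 0, so some subgraph attains it; replacing
  it by the graph induced on its vertices only adds edges.\<close>

lemma quasi_clique_number_attained:
  assumes "finite V" "E \<subseteq> all_pairs V"
  obtains A where "A \<subseteq> V" "card A = quasi_clique_number \<gamma> (V, E)"
    "\<gamma> * real (card A choose 2) \<le> real (card (E \<inter> all_pairs A))"
proof -
  let ?K = "{k. \<exists>H. subgraph H (V, E) \<and> card (verts H) = k \<and> quasi_clique \<gamma> H}"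
  have "finite ?K"
    by (rule finite_subset[of _ "{..card V}"]) (auto simp: subgraph_def assms(1) intro!: card_mono)
  moreover have "0 \<in> ?K"
    by (rule CollectI, rule exI[of _ "({}, {})"])
       (simp add: subgraph_def simple_graph_def quasi_clique_def binomial_eq_0)
  ultimately have "Max ?K \<in> ?K" by (intro Max_in) auto
  then obtain H where H: "subgraph H (V, E)" "card (verts H) = quasi_clique_number \<gamma> (V, E)"
    "quasi_clique \<gamma> H"
    unfolding quasi_clique_number_def by blast
  have "edges H \<subseteq> E \<inter> all_pairs (verts H)" "finite (verts H)" "verts H \<subseteq> V"
    using H(1) by (auto simp: subgraph_def simple_graph_def)
  then have "card (edges H) \<le> card (E \<inter> all_pairs (verts H))"
    by (intro card_mono) (auto simp: finite_all_pairs)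
  then show thesis
    using that[of "verts H"] H \<open>verts H \<subseteq> V\<close> unfolding quasi_clique_def by linarith
qed

text \<open>As the total number of edges is fixed, a lower bound on the number of edges not inside \<open>I\<close>
  is an upper bound on the number of edges inside \<open>I\<close>.\<close>

definition balanced :: "real \<Rightarrow> real \<Rightarrow> 'a set \<Rightarrow> 'a set set \<Rightarrow> bool" where
  "balanced \<gamma> \<eta> V S \<longleftrightarrow>
     card (S \<inter> all_pairs V) = nat \<lceil>\<gamma> * real (card V choose 2)\<rceil> \<and>
     (\<forall>I. I \<subset> V \<longrightarrow>
        \<gamma> * real (card (all_pairs V - all_pairs I)) - \<eta> * real (card V - card I) * real (card V)
        \<le> real (card (S \<inter> (all_pairs V - all_pairs I))))"

text \<open>The probability of a fixed graph with \<open>\<lceil>\<gamma> N\<rceil>\<close> of \<open>N\<close> possible edges under edge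
  probability \<open>p\<close>, divided by its probability under edge probability \<open>\<gamma>\<close>.\<close>

definition tilt :: "real \<Rightarrow> real \<Rightarrow> nat \<Rightarrow> real" where
  "tilt \<gamma> p N = (p / \<gamma>) ^ nat \<lceil>\<gamma> * real N\<rceil> * ((1 - p) / (1 - \<gamma>)) ^ (N - nat \<lceil>\<gamma> * real N\<rceil>)"

section \<open>The cost of changing the edge probability\<close>

lemma nat_ceiling_mult_le: "\<gamma> \<le> 1 \<Longrightarrow> nat \<lceil>\<gamma> * real N\<rceil> \<le> N"
  by (simp add: mult_left_le_one_le nat_le_iff ceiling_le_iff)
     (metis mult.commute mult_left_le of_nat_0_le_iff)

lemma tilt_pos: "0 < p \<Longrightarrow> p < \<gamma> \<Longrightarrow> \<gamma> < 1 \<Longrightarrow> 0 < tilt \<gamma> p N"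
  unfolding tilt_def by simp

text \<open>With exactly \<open>\<gamma> * N\<close> edges the ratio would be
  \<open>exp (- alpha \<gamma> p * N)\<close>. Rounding up adds at most one edge, and one more edge
  costs a factor \<open>\<gamma> * (1 - p) / (p * (1 - \<gamma>))\<close>.\<close>

lemma tilt_ge:
  assumes "0 < p" "p < \<gamma>" "\<gamma> < 1"
  shows "exp (- alpha \<gamma> p * N - ln (\<gamma> * (1 - p) / (p * (1 - \<gamma>)))) \<le> tilt \<gamma> p N"
proof -
  define m where "m = nat \<lceil>\<gamma> * real N\<rceil>"
  define u where "u = ln (\<gamma> * (1 - p) / (p * (1 - \<gamma>)))"
  define v where "v = ln ((1 - p) / (1 - \<gamma>))"
  have "p * (1 - \<gamma>) < \<gamma> * (1 - p)" using assms by (simp add: algebra_simps)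
  then have u: "u > 0" using assms by (simp add: u_def)
  have al: "alpha \<gamma> p = \<gamma> * u - v"
    using assms by (simp add: alpha_def u_def v_def ln_div ln_mult) (simp add: algebra_simps)
  have m: "real m \<le> \<gamma> * real N + 1" "m \<le> N"
    using assms nat_ceiling_mult_le[of \<gamma> N] unfolding m_def by auto
  have "p / \<gamma> = exp (v - u)"
    using assms by (simp add: u_def v_def exp_diff)
  then have "(p / \<gamma>) ^ m = exp ((v - u) * m)"
    using exp_of_nat2_mult[of "v - u" m] by simp
  moreover have "((1 - p) / (1 - \<gamma>)) ^ (N - m) = exp (v * (real N - real m))"
    using exp_of_nat2_mult[of v "N - m"] assms m(2) by (simp add: v_def of_nat_diff)
  ultimately have "tilt \<gamma> p N = exp (v * N - u * m)"
    unfolding tilt_def m_def[symmetric] by (simp add: algebra_simps flip: exp_add)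
  moreover have "u * m \<le> u * (\<gamma> * real N + 1)"
    using m(1) u by (intro mult_left_mono) auto
  ultimately show ?thesis
    unfolding al u_def[symmetric] by (simp add: algebra_simps)
qed

section \<open>Probability that one set, or two sets at once, are balanced\<close>

text \<open>The subset form of the binomial theorem; it evaluates a union bound over subsets
  \<open>I\<close> whose terms depend only on the size of \<open>V - I\<close>.\<close>

lemma sum_power_card_Diff:
  fixes x :: "'b :: comm_ring_1"
  assumes "finite V"
  shows "(\<Sum>I\<in>Pow V. x ^ card (V - I)) = (1 + x) ^ card V"
  using prod_add[OF assms, of "\<lambda>_. 1" "\<lambda>_. x"] by simp

text \<open>Hoeffding's inequality. With \<open>r = card (V - I)\<close> and
  \<open>k = card V\<close>, at most \<open>r * k\<close> pairs of \<open>V\<close> are not inside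
  \<open>I\<close>, while the permitted deviation is \<open>t = \<eta> * r * k\<close>. So
  \<open>2 * t^2\<close> over the number of pairs is at least
  \<open>2 * \<eta>^2 * k * r\<close>.\<close>

lemma prob_few_edges_le:
  assumes "finite E" "all_pairs V \<subseteq> E" "finite V" "I \<subset> V" "\<gamma> \<in> {0<..<1}" "\<eta> > 0"
  shows "measure_pmf.prob (random_subset E \<gamma>) {S. real (card (S \<inter> (all_pairs V - all_pairs I)))
      < \<gamma> * real (card (all_pairs V - all_pairs I)) - \<eta> * real (card V - card I) * real (card V)}
    \<le> exp (- 2 * \<eta>\<^sup>2 * real (card V)) ^ card (V - I)"
proof -
  define D where "D = all_pairs V - all_pairs I"
  define K where "K = card D"
  define r where "r = card V - card I"
  define t where "t = \<eta> * real r * real (card V)"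
  have fI: "finite I" using assms finite_subset by auto
  have IV: "card I < card V" using assms psubset_card_mono by auto
  have r: "card (V - I) = r" "r > 0"
    using IV assms fI by (auto simp: card_Diff_subset r_def)
  have K: "real K \<le> real r * real (card V)"
  proof -
    have "real K = real (card V choose 2) - real (card I choose 2)"
      using assms IV by (simp add: K_def D_def card_all_pairs_Diff of_nat_diff choose_two_mono)
    also have "\<dots> = (real (card V) - real (card I)) * (real (card V) + real (card I) - 1) / 2"
      by (simp add: real_choose_two field_simps)
    also have "\<dots> \<le> (real (card V) - real (card I)) * (2 * real (card V)) / 2"
      using IV by (intro divide_right_mono mult_left_mono) auto
    also have "\<dots> = real r * real (card V)"
      using IV by (simp add: r_def of_nat_diff)
    finally show ?thesis .
  qed
  have t: "t > 0" using assms r IV by (simp add: t_def)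
  have "measure_pmf.prob (random_subset E \<gamma>) {S. real (card (S \<inter> D)) < \<gamma> * real K - t} =
     measure_pmf.prob (binomial_pmf K \<gamma>) {i. real i < \<gamma> * real K - t}"
    unfolding K_def
    using assms by (intro prob_random_subset_card) (auto simp: D_def)
  also have "\<dots> \<le> exp (- 2 * \<eta>\<^sup>2 * real (card V)) ^ r"
  proof (cases "K = 0")
    \<comment> \<open>Without pairs the threshold is the negative number \<open>- t\<close> and the
      event is empty.\<close>
    case True
    then show ?thesis using t by simp
  next
    case False
    interpret binomial_distribution K \<gamma> by unfold_locales (use assms in auto)
    have "measure_pmf.prob (binomial_pmf K \<gamma>) {i. real i < \<gamma> * real K - t} \<le>
       measure_pmf.prob (binomial_pmf K \<gamma>) {i. real i \<le> real K * \<gamma> - t}"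
      by (intro measure_pmf.finite_measure_mono) (auto simp: mult.commute)
    also have "\<dots> \<le> exp (- 2 * t\<^sup>2 / real K)"
      using prob_le[of t] t False by simp
    also have "\<dots> \<le> exp (- 2 * \<eta>\<^sup>2 * real (card V) * r)"
    proof -
      have "2 * \<eta>\<^sup>2 * real (card V) * r * real K \<le> 2 * \<eta>\<^sup>2 * real (card V) * r * (real r * real (card V))"
        using K by (intro mult_left_mono) auto
      also have "\<dots> = 2 * t\<^sup>2" by (simp add: t_def power2_eq_square)
      finally show ?thesis using False by (simp add: field_simps)
    qed
    also have "\<dots> = exp (- 2 * \<eta>\<^sup>2 * real (card V)) ^ r"
      by (rule exp_of_nat2_mult)
    finally show ?thesis .
  qed
  finally show ?thesis unfolding r t_def D_def K_def r_def .
qed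

text \<open>Under edge probability \<gamma> the exact edge count still has polynomially large
  probability; the union bound over all violated balance conditions is subtracted from it.\<close>

lemma prob_balanced_ge:
  assumes "finite E" "all_pairs V \<subseteq> E" "finite V" "0 < p" "p < \<gamma>" "\<gamma> < 1" "\<eta> > 0"
    and N: "N = card V choose 2" and "1 \<le> \<gamma> * real N"
  shows "tilt \<gamma> p N * (1 / (2 * (real N + 1)) - ((1 + exp (- 2 * \<eta>\<^sup>2 * real (card V))) ^ card V - 1))
     \<le> measure_pmf.prob (random_subset E p) {S. balanced \<gamma> \<eta> V S}"
proof -
  define m where "m = nat \<lceil>\<gamma> * real N\<rceil>"
  let ?F = "all_pairs V"
  let ?M = "random_subset ?F \<gamma>"
  define bad where "bad I = {S. real (card (S \<inter> (all_pairs V - all_pairs I)))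
      < \<gamma> * real (card (all_pairs V - all_pairs I)) - \<eta> * real (card V - card I) * real (card V)}" for I
  define G where "G = {S. \<forall>I. I \<subset> V \<longrightarrow> S \<notin> bad I}"
  define x where "x = exp (- 2 * \<eta>\<^sup>2 * real (card V))"
  have finF: "finite ?F" "card ?F = N" using assms by (auto simp: finite_all_pairs card_all_pairs)
  have "measure_pmf.prob (random_subset E p) {S. balanced \<gamma> \<eta> V S} =
      measure_pmf.prob (random_subset E p) {S. card (S \<inter> ?F) = m \<and> S \<inter> ?F \<in> G}"
  proof -
    have "(S \<inter> ?F) \<inter> (all_pairs V - all_pairs I) = S \<inter> (all_pairs V - all_pairs I)" for S I :: "_ set"
      by auto
    then show ?thesis
      unfolding balanced_def G_def bad_def m_def N by (simp add: not_less)
  qed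
  also have "\<dots> = measure_pmf.prob (random_subset ?F p) {S. card S = m \<and> S \<in> G}"
    using assms by (intro prob_random_subset_Int) auto
  also have "\<dots> = tilt \<gamma> p N * measure_pmf.prob ?M {S. card S = m \<and> S \<in> G}"
    using prob_random_subset_change[of ?F p \<gamma> m "\<lambda>S. S \<in> G"] assms(4-6)
      nat_ceiling_mult_le[of \<gamma> N] finF
    by (simp add: tilt_def m_def[symmetric])
  finally have eq: "measure_pmf.prob (random_subset E p) {S. balanced \<gamma> \<eta> V S} =
     tilt \<gamma> p N * measure_pmf.prob ?M {S. card S = m \<and> S \<in> G}" .
  have "1 / (2 * (real N + 1)) \<le> pmf (binomial_pmf N \<gamma>) m"
    unfolding m_def using assms by (intro pmf_binomial_ceiling_ge) auto
  also have "\<dots> = measure_pmf.prob (binomial_pmf N \<gamma>) {i. i = m}"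
    by (simp add: measure_pmf_single)
  also have "\<dots> = measure_pmf.prob ?M {S. card (S \<inter> ?F) = m}"
    using assms finF by (subst prob_random_subset_card) auto
  also have "\<dots> = measure_pmf.prob ?M {S. card S = m}"
    by (rule prob_random_subset_Int) (use finF in auto)
  \<comment> \<open>An edge set of the right size satisfies all balance conditions or is bad for
    some proper subset.\<close>
  also have "\<dots> \<le> measure_pmf.prob ?M ({S. card S = m \<and> S \<in> G} \<union> (\<Union>I\<in>Pow V - {V}. bad I))"
    by (intro measure_pmf.finite_measure_mono) (auto simp: G_def)
  also have "\<dots> \<le> measure_pmf.prob ?M {S. card S = m \<and> S \<in> G} +
      measure_pmf.prob ?M (\<Union>I\<in>Pow V - {V}. bad I)"
    by (intro measure_Un_le) auto
  also have "measure_pmf.prob ?M (\<Union>I\<in>Pow V - {V}. bad I) \<le>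
      (\<Sum>I\<in>Pow V - {V}. measure_pmf.prob ?M (bad I))"
    using assms by (intro measure_pmf.finite_measure_subadditive_finite) auto
  also have "\<dots> \<le> (\<Sum>I\<in>Pow V - {V}. x ^ card (V - I))"
    unfolding bad_def x_def using assms finF by (intro sum_mono prob_few_edges_le) auto
  \<comment> \<open>The omitted subset \<open>I = V\<close> accounts for the subtracted 1.\<close>
  also have "\<dots> = (1 + x) ^ card V - 1"
    using assms by (simp add: sum_diff1 sum_power_card_Diff)
  finally have "1 / (2 * (real N + 1)) - ((1 + x) ^ card V - 1) \<le>
     measure_pmf.prob ?M {S. card S = m \<and> S \<in> G}" by linarith
  then show ?thesis
    unfolding eq x_def[symmetric] using tilt_pos[of p \<gamma> N] assms by (intro mult_left_mono) auto
qed

text \<open>The pairs inside \<open>V\<close> and the pairs of \<open>W\<close> outside the overlap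
  are disjoint, hence independent. The edge count of \<open>V\<close> contributes the factor
  \<open>tilt\<close>, the rest of \<open>W\<close> falls under the Chernoff bound with slack. The
  slack \<open>card I choose 2\<close> comes from the edge count of \<open>W\<close> alone, the
  other one from its balance with respect to \<open>I\<close>.\<close>

lemma prob_balanced_Int_le:
  assumes "finite E" "all_pairs V \<subseteq> E" "all_pairs W \<subseteq> E" "finite V" "finite W"
    and "0 < p" "p < \<gamma>" "\<gamma> < 1"
    and k: "card V = k" "card W = k" and I: "I = V \<inter> W"
    and s: "s = real (card I choose 2) \<or> s = \<eta> * real (k - card I) * real k"
  shows "measure_pmf.prob (random_subset E p) ({S. balanced \<gamma> \<eta> V S} \<inter> {S. balanced \<gamma> \<eta> W S})
    \<le> tilt \<gamma> p (k choose 2) *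
       exp (- alpha \<gamma> p * (real (k choose 2) - real (card I choose 2))
            + ln (\<gamma> * (1 - p) / (p * (1 - \<gamma>))) * s)"
proof -
  define N where "N = k choose 2"
  define m where "m = nat \<lceil>\<gamma> * real N\<rceil>"
  define D where "D = all_pairs W - all_pairs I"
  let ?F = "all_pairs V"
  let ?M = "random_subset E p"
  have IW: "I \<subseteq> W" "finite I" "card I \<le> k"
    using I k assms by (auto intro: card_mono)
  have finF: "finite ?F" "card ?F = N" using assms by (auto simp: finite_all_pairs card_all_pairs N_def)
  have MN: "(card I choose 2) \<le> N" unfolding N_def using IW by (intro choose_two_mono)
  have cD: "real (card D) = real N - real (card I choose 2)"
    using assms IW MN by (simp add: D_def card_all_pairs_Diff N_def of_nat_diff)
  have W: "balanced \<gamma> \<eta> W S \<Longrightarrow> \<gamma> * real (card D) - s \<le> real (card (S \<inter> D))" for S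
  proof -
    assume bal: "balanced \<gamma> \<eta> W S"
    show ?thesis
    proof (cases "s = real (card I choose 2)")
      \<comment> \<open>At worst every pair inside \<open>I\<close> is an edge, and the remaining
        edges lie in \<open>D\<close>.\<close>
      case True
      have "card (S \<inter> all_pairs W) = m"
        using bal k by (simp add: balanced_def m_def N_def)
      moreover have "S \<inter> all_pairs W \<subseteq> (S \<inter> D) \<union> all_pairs I" by (auto simp: D_def)
      then have "card (S \<inter> all_pairs W) \<le> card ((S \<inter> D) \<union> all_pairs I)"
        using assms IW by (intro card_mono) (auto simp: D_def finite_all_pairs)
      ultimately have "m \<le> card (S \<inter> D) + (card I choose 2)"
        using card_Un_le[of "S \<inter> D" "all_pairs I"] IW by (simp add: card_all_pairs)
      then have "real m - real (card I choose 2) \<le> real (card (S \<inter> D))" by linarith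
      moreover have "\<gamma> * real N \<le> real m" unfolding m_def by linarith
      moreover have "\<gamma> * real (card I choose 2) \<ge> 0" using assms by simp
      ultimately show ?thesis unfolding cD True by (simp add: algebra_simps)
    next
      case False
      then have s': "s = \<eta> * real (k - card I) * real k" using s by simp
      show ?thesis
      proof (cases "I = W")
        \<comment> \<open>Balance speaks of proper subsets only, but here \<open>D\<close> is empty
          and \<open>s\<close> is 0.\<close>
        case True
        then show ?thesis using s' k by (simp add: D_def)
      next
        case False
        then have "I \<subset> W" using IW by auto
        then have "\<gamma> * real (card D) - \<eta> * real (card W - card I) * real (card W) \<le> real (card (S \<inter> D))"
          using bal unfolding balanced_def D_def by blast
        then show ?thesis unfolding s' k .
      qed
    qed
  qed
  have V: "balanced \<gamma> \<eta> V S \<Longrightarrow> card (S \<inter> ?F) = m" for S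
    using k by (simp add: balanced_def m_def N_def)
  have "measure_pmf.prob ?M ({S. balanced \<gamma> \<eta> V S} \<inter> {S. balanced \<gamma> \<eta> W S}) \<le>
      measure_pmf.prob ?M {S. card (S \<inter> ?F) = m \<and> \<gamma> * real (card D) - s \<le> real (card (S \<inter> D))}"
    by (intro measure_pmf.finite_measure_mono) (use V W in blast, simp)
  also have "\<dots> = measure_pmf.prob ?M {S. card (S \<inter> ?F) = m} *
      measure_pmf.prob ?M {S. \<gamma> * real (card D) - s \<le> real (card (S \<inter> D))}"
  proof (rule prob_random_subset_indep)
    show "?F \<inter> D = {}" using all_pairs_Int[of V W] I by (auto simp: D_def)
  qed (use assms in \<open>auto simp: D_def\<close>)
  also have "measure_pmf.prob ?M {S. card (S \<inter> ?F) = m} \<le> tilt \<gamma> p N"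
  proof -
    have "measure_pmf.prob ?M {S. card (S \<inter> ?F) = m} =
        measure_pmf.prob (random_subset ?F p) {S. card S = m \<and> True}"
      using assms by (simp add: prob_random_subset_Int[where P = "\<lambda>S. card S = m"])
    also have "\<dots> = tilt \<gamma> p N * measure_pmf.prob (random_subset ?F \<gamma>) {S. card S = m \<and> True}"
      using prob_random_subset_change[of ?F p \<gamma> m "\<lambda>_. True"] assms(6-8)
        nat_ceiling_mult_le[of \<gamma> N] finF
      by (simp add: tilt_def m_def[symmetric])
    also have "\<dots> \<le> tilt \<gamma> p N * 1"
      using tilt_pos[of p \<gamma> N] assms by (intro mult_left_mono) auto
    finally show ?thesis by simp
  qed
  also have "measure_pmf.prob ?M {S. \<gamma> * real (card D) - s \<le> real (card (S \<inter> D))} =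
      measure_pmf.prob (binomial_pmf (card D) p) {i. \<gamma> * real (card D) - s \<le> real i}"
    using assms by (intro prob_random_subset_card) (auto simp: D_def)
  also have "\<dots> \<le> exp (- alpha \<gamma> p * real (card D) + ln (\<gamma> * (1 - p) / (p * (1 - \<gamma>))) * s)"
    using assms by (intro binomial_tail_exp_le)
  finally show ?thesis
    unfolding cD N_def using tilt_pos[of p \<gamma> N] assms by (auto simp: mult_right_mono N_def)
qed

subsection \<open>Asymptotic estimates\<close>

text \<open>Lower half of Stirling's formula; the induction step amounts to
  \<open>k * ln (1 + 1 / k) \<le> 1\<close>.\<close>

lemma ln_fact_ge: "real k * ln (real k) - real k \<le> ln (fact k)"
proof (induction k)
  case (Suc k)
  show ?case
  proof (cases "k = 0")
    case False
    then have "ln (1 + 1 / real k) \<le> 1 / real k"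
      by (intro ln_add_one_self_le_self) auto
    moreover have "ln (1 + 1 / real k) = ln (real (Suc k)) - ln (real k)"
      using False by (subst ln_divide_pos[symmetric]) (auto simp: field_simps)
    ultimately have "ln (real (Suc k)) - ln (real k) \<le> 1 / real k" by simp
    then have "real k * (ln (real (Suc k)) - ln (real k)) \<le> 1"
      using False by (simp add: field_simps del: of_nat_Suc)
    then show ?thesis
      using Suc False by (simp add: ln_mult algebra_simps del: of_nat_Suc) (simp add: algebra_simps)
  qed simp
qed simp

text \<open>Matches the lower bound up to \<open>1 + ln k\<close>; the induction step amounts to
  \<open>(k + 1) * ln (k / (k + 1)) \<le> -1\<close>, and \<open>k = 1\<close> gives
  equality.\<close>

lemma ln_fact_le: "k \<ge> 1 \<Longrightarrow> ln (fact k) \<le> 1 + ln (real k) + real k * ln (real k) - real k"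
proof (induction k rule: nat_induct_at_least)
  case (Suc k)
  have "ln (real k / real (Suc k)) \<le> real k / real (Suc k) - 1"
    using Suc.hyps by (intro ln_le_minus_one) auto
  then have "ln (real k) - ln (real (Suc k)) \<le> - 1 / real (Suc k)"
    using Suc.hyps by (simp add: ln_div field_simps)
  then have "real (Suc k) * (ln (real k) - ln (real (Suc k))) \<le> -1"
    by (simp add: field_simps)
  then show ?case
    using Suc by (simp add: ln_mult algebra_simps del: of_nat_Suc) (simp add: algebra_simps)
qed simp

section \<open>Binomial coefficients\<close>

lemma binomial_le_exp:
  assumes "0 < k" "k \<le> n"
  shows "real (n choose k) \<le> exp (real k * (ln (real n) + 1 - ln (real k)))"
proof -
  have "real (n choose k) * fact k \<le> real n ^ k"
    using binomial_fact_pow[of n k] by (metis of_nat_fact of_nat_le_iff of_nat_mult of_nat_power)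
  then have "ln (real (n choose k) * fact k) \<le> ln (real n ^ k)"
    using assms by (subst ln_le_cancel_iff) auto
  then have "ln (real (n choose k)) \<le> real k * (ln (real n) + 1 - ln (real k))"
    using ln_fact_ge[of k] assms by (simp add: ln_mult ln_realpow algebra_simps)
  then show ?thesis
    using assms by (metis exp_le_cancel_iff exp_ln of_nat_0_less_iff zero_less_binomial)
qed

text \<open>The falling factorial is at least \<open>(n - k) ^ k\<close>, and
  \<open>2 * k^2 \<le> n\<close> makes this at least \<open>n ^ k / exp 1\<close>. The 2 in the
  exponent collects this loss and the constant from the upper bound on
  \<open>ln (fact k)\<close>.\<close>

lemma binomial_ge_exp:
  assumes "0 < k" "2 * (real k)\<^sup>2 \<le> real n"
  shows "exp (real k * (ln (real n) + 1 - ln (real k)) - ln (real k) - 2) \<le> real (n choose k)"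
proof -
  have "real k \<le> (real k)\<^sup>2" using assms(1) by (simp add: power2_eq_square)
  then have kn: "2 * real k \<le> real n" "k \<le> n" using assms by linarith+
  have fall: "(real n - real k) ^ k \<le> real (n choose k) * fact k"
  proof -
    have "(real n - real k) ^ k = (\<Prod>i<k. real n - real k)" by simp
    also have "\<dots> \<le> (\<Prod>i<k. real n - real i)" using kn by (intro prod_mono) auto
    also have "\<dots> = (real n gchoose k) * fact k"
      by (simp add: gbinomial_prod_rev lessThan_atLeast0)
    finally show ?thesis by (simp add: binomial_gbinomial)
  qed
  have pos: "real n - real k > 0" using kn assms(1) by linarith
  have "ln ((real n - real k) ^ k) \<le> ln (real (n choose k) * fact k)"
    using fall pos kn by (subst ln_le_cancel_iff) auto
  then have "real k * ln (real n - real k) \<le> ln (real (n choose k)) + ln (fact k)"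
    using pos kn by (simp add: ln_mult ln_realpow)
  moreover have "real k * ln (real n) - 1 \<le> real k * ln (real n - real k)"
  proof -
    define t where "t = real k / (real n - real k)"
    have "ln (real n / (real n - real k)) \<le> real n / (real n - real k) - 1"
      using pos kn assms(1) by (intro ln_le_minus_one) auto
    also have "\<dots> = t" using pos by (simp add: t_def field_simps)
    finally have "ln (real n) - ln (real n - real k) \<le> t"
      using pos kn assms(1) by (simp add: ln_div)
    then have "real k * (ln (real n) - ln (real n - real k)) \<le> real k * t"
      by (intro mult_left_mono) auto
    also have "real k * t \<le> 1"
      using pos kn assms by (simp add: t_def divide_le_eq power2_eq_square)
    finally show ?thesis by (simp add: algebra_simps)
  qed
  ultimately have "real k * (ln (real n) + 1 - ln (real k)) - ln (real k) - 2 \<le> ln (real (n choose k))"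
    using ln_fact_le[of k] assms(1) by (simp add: algebra_simps)
  then show ?thesis using kn by (subst (asm) ln_ge_iff) auto
qed

text \<open>The ratio of the two coefficients is the product of \<open>(k - i) / (n - i)\<close>
  over \<open>i < l\<close>, each factor being at most \<open>k / n\<close>.\<close>

lemma binomial_Diff_mult_pow_le:
  assumes "l \<le> k" "k \<le> n"
  shows "real ((n - l) choose (k - l)) * real n ^ l \<le> real (n choose k) * real k ^ l"
  using assms(1)
proof (induction l)
  case (Suc l)
  have "(k - l) * ((n - l) choose (k - l)) = (n - l) * ((n - Suc l) choose (k - Suc l))"
    using times_binomial_minus1_eq[of "k - l" "n - l"] Suc.prems by simp
  then have eq: "(real n - real l) * real ((n - Suc l) choose (k - Suc l)) =
      (real k - real l) * real ((n - l) choose (k - l))"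
    using Suc.prems assms(2) by (metis of_nat_mult of_nat_diff Suc_leD le_trans)
  have pos: "real n - real l > 0" using Suc.prems assms(2) by linarith
  have "real n * (real k - real l) \<le> real k * (real n - real l)"
    using mult_left_mono[of "real k" "real n" "real l"] assms(2) by (simp add: algebra_simps)
  then have "real n * (real k - real l) * real ((n - l) choose (k - l)) \<le>
      real k * (real n - real l) * real ((n - l) choose (k - l))"
    by (intro mult_right_mono) auto
  then have "(real n - real l) * (real n * real ((n - Suc l) choose (k - Suc l))) \<le>
      (real n - real l) * (real k * real ((n - l) choose (k - l)))"
    using eq by (simp add: mult_ac)
  then have step: "real n * real ((n - Suc l) choose (k - Suc l)) \<le> real k * real ((n - l) choose (k - l))"
    using pos by simp
  have "real ((n - Suc l) choose (k - Suc l)) * real n ^ Suc l =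
     real n ^ l * (real n * real ((n - Suc l) choose (k - Suc l)))" by simp
  also have "\<dots> \<le> real n ^ l * (real k * real ((n - l) choose (k - l)))"
    using step by (intro mult_left_mono) auto
  also have "\<dots> = real k * (real ((n - l) choose (k - l)) * real n ^ l)" by simp
  also have "\<dots> \<le> real k * (real (n choose k) * real k ^ l)"
    using Suc by (intro mult_left_mono) auto
  finally show ?case by (simp add: mult_ac)
qed simp

section \<open>Asymptotics of the location\<close>

text \<open>The location is a multiple of \<open>ln n - ln (ln n) + c\<close> for some constant
  \<open>c\<close>, so its logarithm is \<open>ln (ln n)\<close> up to a constant and a vanishing
  error.\<close>

lemma ln_ln_asymp:
  fixes c :: real
  shows "((\<lambda>n::nat. ln (ln (real n)) - ln (ln (real n) - ln (ln (real n)) + c)) \<longlongrightarrow> 0) at_top"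
  by real_asymp

text \<open>This is the relative entropy of the Bernoulli distributions with parameters \<gamma> and
  \<open>p\<close>. Positivity follows from \<open>ln x \<le> x - 1\<close>, which is strict in the
  first term because \<open>p\<close> differs from \<gamma>.\<close>

lemma alpha_pos:
  assumes "0 < p" "p < \<gamma>" "\<gamma> < 1"
  shows "0 < alpha \<gamma> p"
proof -
  have "\<gamma> * ln (p / \<gamma>) < \<gamma> * (p / \<gamma> - 1)"
  proof -
    have "ln (p / \<gamma>) \<noteq> p / \<gamma> - 1"
      using ln_eq_minus_one[of "p / \<gamma>"] assms by auto
    then show ?thesis using ln_le_minus_one[of "p / \<gamma>"] assms by simp
  qed
  moreover have "(1 - \<gamma>) * ln ((1 - p) / (1 - \<gamma>)) \<le> (1 - \<gamma>) * ((1 - p) / (1 - \<gamma>) - 1)"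
    using assms by (intro mult_left_mono ln_le_minus_one) auto
  moreover have "\<gamma> * (p / \<gamma> - 1) + (1 - \<gamma>) * ((1 - p) / (1 - \<gamma>) - 1) = 0"
    using assms by (simp add: field_simps)
  ultimately show ?thesis
    unfolding alpha_def using assms by (simp add: ln_div algebra_simps)
qed

text \<open>Up to lower order terms, the expected number of \<open>k\<close>-vertex quasi-cliques is
  \<open>exp\<close> of \<open>k * (ln n + 1 - ln k - a * (k - 1) / 2)\<close>. By the second claim
  the bracket changes sign at \<open>k = L + 1\<close>; a shift \<open>c\<close> inside the
  logarithm does not affect the limit. The last two claims compare \<open>ln n\<close> with
  \<open>a * L / 2\<close> for the overlap estimate.\<close>

lemma quasi_clique_location_asymp:
  fixes p \<gamma> :: real
  assumes "0 < p" "p < \<gamma>" "\<gamma> < 1"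
  defines "a \<equiv> alpha \<gamma> p" and "L \<equiv> quasi_clique_location \<gamma> p"
  shows "filterlim L at_top at_top"
    and "((\<lambda>n. ln (real n) + 1 - ln (L n + c) - a * (L n + d) / 2) \<longlongrightarrow> - a * d / 2) at_top"
    and "eventually (\<lambda>n. 2 * (L n + c)\<^sup>2 \<le> real n) at_top"
    and "eventually (\<lambda>n. ln (real n) \<le> a * (L n + d) / 2 + 2 * ln (L n + c)) at_top"
    and "eventually (\<lambda>n. a * (L n + c) / 2 \<le> ln (real n)) at_top"
proof -
  have a: "a > 0" unfolding a_def using assms alpha_pos by blast
  \<comment> \<open>This is \<open>ln (exp 1 * a / 2)\<close>, so \<open>y\<close> below is
    \<open>a / 2\<close> times the location.\<close>
  define b where "b = 1 - ln (2 / a)"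
  define y where "y n = ln (real n) - ln (ln (real n)) + b" for n :: nat
  have L: "L n = 2 / a * y n" for n
    using a by (simp add: L_def quasi_clique_location_def y_def b_def a_def ln_mult ln_div)
  have ytop: "filterlim y at_top at_top"
    unfolding y_def by real_asymp
  show Ltop: "filterlim L at_top at_top"
    unfolding L using a ytop by (intro filterlim_tendsto_pos_mult_at_top[OF tendsto_const]) auto
  have ypos: "eventually (\<lambda>n. y n + e > 0) at_top" for e
    using filterlim_at_top_dense[THEN iffD1, OF ytop, rule_format, of "- e"]
    by eventually_elim simp
  have lnL: "eventually (\<lambda>n. ln (L n + c) = ln (2 / a) + ln (y n + a * c / 2)) at_top" for c
    using ypos[of "a * c / 2"]
  proof eventually_elim
    case (elim n)
    have "L n + c = (2 / a) * (y n + a * c / 2)" using a by (simp add: L field_simps)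
    then show ?case using elim a ln_mult_pos[of "2 / a" "y n + a * c / 2"] by simp
  qed
  show lim: "((\<lambda>n. ln (real n) + 1 - ln (L n + c) - a * (L n + d) / 2) \<longlongrightarrow> - a * d / 2) at_top"
  proof -
    have "((\<lambda>n. (ln (ln (real n)) - ln (ln (real n) - ln (ln (real n)) + (b + a * c / 2))) - a * d / 2)
        \<longlongrightarrow> 0 - a * d / 2) at_top"
      by (intro tendsto_intros ln_ln_asymp)
    then show ?thesis
    proof (rule Lim_transform_eventually[THEN tendsto_eq_rhs])
      show "\<forall>\<^sub>F n in at_top. (ln (ln (real n)) - ln (ln (real n) - ln (ln (real n)) + (b + a * c / 2))) - a * d / 2
         = ln (real n) + 1 - ln (L n + c) - a * (L n + d) / 2"
        using lnL[of c]
      proof eventually_elim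
        case (elim n)
        have "a * (L n + d) / 2 = y n + a * d / 2" using a by (simp add: L field_simps)
        then show ?case unfolding elim by (simp add: y_def b_def algebra_simps)
      qed
    qed simp
  qed
  show "eventually (\<lambda>n. 2 * (L n + c)\<^sup>2 \<le> real n) at_top"
    unfolding L y_def using a by real_asymp
  show "eventually (\<lambda>n. ln (real n) \<le> a * (L n + d) / 2 + 2 * ln (L n + c)) at_top"
    unfolding L y_def using a by real_asymp
  show "eventually (\<lambda>n. a * (L n + c) / 2 \<le> ln (real n)) at_top"
    unfolding L y_def using a by real_asymp
qed

subsection \<open>The second moment\<close>

lemma card_supersets:
  assumes "finite U" "I \<subseteq> U" "card I \<le> k"
  shows "card {W. I \<subseteq> W \<and> W \<subseteq> U \<and> card W = k} = (card U - card I) choose (k - card I)"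
proof -
  have fI: "finite I" using assms finite_subset by auto
  have "bij_betw (\<lambda>B. I \<union> B) {B. B \<subseteq> U - I \<and> card B = k - card I} {W. I \<subseteq> W \<and> W \<subseteq> U \<and> card W = k}"
  proof (rule bij_betw_byWitness[where f' = "\<lambda>W. W - I"])
    show "(\<lambda>B. I \<union> B) ` {B. B \<subseteq> U - I \<and> card B = k - card I} \<subseteq> {W. I \<subseteq> W \<and> W \<subseteq> U \<and> card W = k}"
    proof clarify
      fix B assume B: "B \<subseteq> U - I" "card B = k - card I"
      have "card (I \<union> B) = card I + card B"
        using B assms fI finite_subset[of B U] by (intro card_Un_disjoint) auto
      then show "I \<subseteq> I \<union> B \<and> I \<union> B \<subseteq> U \<and> card (I \<union> B) = k"
        using B assms by auto
    qed
  qed (use fI in \<open>auto simp: card_Diff_subset\<close>)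
  then have "card {W. I \<subseteq> W \<and> W \<subseteq> U \<and> card W = k} = card {B. B \<subseteq> U - I \<and> card B = k - card I}"
    by (simp add: bij_betw_same_card)
  also have "\<dots> = card (U - I) choose (k - card I)"
    using assms by (intro n_subsets) auto
  finally show ?thesis using assms fI by (simp add: card_Diff_subset)
qed

text \<open>Choose the overlap \<open>I\<close> inside \<open>V\<close> and extend it to a
  \<open>k\<close>-set. Extensions may meet \<open>V\<close> outside \<open>I\<close>, hence only an
  upper bound.\<close>

lemma card_sets_with_Int_le:
  assumes "finite U" "V \<subseteq> U" "card V = k" "l \<le> k"
  shows "card {W. W \<subseteq> U \<and> card W = k \<and> card (V \<inter> W) = l} \<le>
    (k choose l) * ((card U - l) choose (k - l))"
proof -
  have fV: "finite V" using assms finite_subset by auto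
  have "{W. W \<subseteq> U \<and> card W = k \<and> card (V \<inter> W) = l} \<subseteq>
    (\<Union>I\<in>{I. I \<subseteq> V \<and> card I = l}. {W. I \<subseteq> W \<and> W \<subseteq> U \<and> card W = k})"
    by auto
  then have "card {W. W \<subseteq> U \<and> card W = k \<and> card (V \<inter> W) = l} \<le>
    card (\<Union>I\<in>{I. I \<subseteq> V \<and> card I = l}. {W. I \<subseteq> W \<and> W \<subseteq> U \<and> card W = k})"
    using assms fV by (intro card_mono) auto
  also have "\<dots> \<le> (\<Sum>I\<in>{I. I \<subseteq> V \<and> card I = l}. card {W. I \<subseteq> W \<and> W \<subseteq> U \<and> card W = k})"
    using fV by (intro card_UN_le) auto
  also have "\<dots> = (\<Sum>I\<in>{I. I \<subseteq> V \<and> card I = l}. (card U - l) choose (k - l))"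
    using assms by (intro sum.cong refl) (auto simp: card_supersets)
  also have "\<dots> = (k choose l) * ((card U - l) choose (k - l))"
    using fV assms by (simp add: n_subsets)
  finally show ?thesis .
qed

text \<open>Here \<open>ln n\<close> is about \<open>a * k / 2\<close>. If
  \<open>l < \<delta> * k\<close>, nothing is used about edges in the overlap: there are at most
  \<open>k ^ (2 * l) / n ^ l\<close> times \<open>n choose k\<close> choices, and \<delta> keeps the
  edge factor below \<open>exp (l * a * k / 4)\<close>. Otherwise the second set arises by
  exchanging \<open>r = k - l\<close> vertices in at most \<open>(k * n) ^ r\<close> ways, and
  balance is used: \<eta> makes its error \<open>a * \<delta> * k / 4\<close> per exchanged vertex,
  at most half of the margin \<open>a * l / 2\<close>.\<close>

lemma overlap_term_le:
  fixes a u \<eta> \<delta> c :: real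
  assumes pos: "0 < a" "0 < u" "0 < c"
    and \<delta>: "\<delta> = a / (2 * (a + u))" and \<eta>: "\<eta> = a * \<delta> / (4 * u)"
    and l: "2 \<le> l" "l \<le> k" "k \<le> n"
    and E: "exp (a * real (k choose 2) + c * real k) \<le> real (n choose k)"
    and ln_n: "a * (real k - 1) / 2 \<le> ln (real n)" "ln (real n) \<le> a * real k / 2 + 2 * ln (real k)"
    and big: "2 * ln (real k) + a / 2 \<le> a * real k / 8" "3 * ln (real k) + a / 2 \<le> a * \<delta> * real k / 4"
  obtains s where "s = real (l choose 2) \<or> s = \<eta> * real (k - l) * real k"
    "real (k choose l) * real ((n - l) choose (k - l)) * exp (a * real (l choose 2) + u * s) \<le>
     real (n choose k) * (exp (- a * real k / 8) + exp (- c * real k))"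
proof (cases "real l < \<delta> * real k")
  case True
  define s where "s = real (l choose 2)"
  have kn: "real k > 0" "real n > 0" using l by auto
  have "real (k choose l) * real ((n - l) choose (k - l)) * exp (a * real (l choose 2) + u * s) * real n ^ l
    = real (k choose l) * (real ((n - l) choose (k - l)) * real n ^ l) * exp ((a + u) * s)"
    by (simp add: s_def algebra_simps)
  also have "\<dots> \<le> real k ^ l * (real (n choose k) * real k ^ l) * exp ((a + u) * s)"
  proof -
    have "real (k choose l) \<le> real k ^ l"
      using binomial_le_pow[OF l(2)] by (simp flip: of_nat_power)
    then show ?thesis
      using binomial_Diff_mult_pow_le[OF l(2,3)] by (intro mult_right_mono[OF mult_mono]) auto
  qed
  also have "\<dots> = real (n choose k) * exp (real l * (2 * ln (real k)) + (a + u) * s)"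
  proof -
    have "real k ^ l = exp (real l * ln (real k))"
      using kn by (simp add: exp_of_nat_mult)
    then show ?thesis by (simp add: exp_add algebra_simps flip: exp_add)
  qed
  also have "\<dots> \<le> real (n choose k) * (exp (- a * real k / 8) * exp (real l * ln (real n)))"
  proof -
    have "(a + u) * s = real l * ((a + u) * (real l - 1) / 2)"
      by (simp add: s_def real_choose_two)
    also have "\<dots> \<le> real l * (a * real k / 4)"
    proof (rule mult_left_mono)
      have "(a + u) * (real l - 1) / 2 \<le> (a + u) * (\<delta> * real k) / 2"
        using True pos by (intro divide_right_mono mult_left_mono) auto
      also have "\<dots> = a * real k / 4" using pos by (simp add: \<delta> field_simps)
      finally show "(a + u) * (real l - 1) / 2 \<le> a * real k / 4" .
    qed simp
    finally have "real l * (2 * ln (real k)) + (a + u) * s - real l * ln (real n) \<le>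
      real l * (2 * ln (real k) + a * real k / 4 - ln (real n))"
      by (simp add: algebra_simps)
    also have "\<dots> \<le> real l * (- a * real k / 8)"
      using ln_n big by (intro mult_left_mono) (auto simp: field_simps)
    also have "\<dots> \<le> 1 * (- a * real k / 8)"
      using l pos by (intro mult_right_mono_neg) auto
    finally show ?thesis by (intro mult_left_mono) (auto simp flip: exp_add)
  qed
  also have "\<dots> = real (n choose k) * exp (- a * real k / 8) * real n ^ l"
    using kn by (simp add: exp_of_nat_mult)
  also have "\<dots> \<le> real (n choose k) * (exp (- a * real k / 8) + exp (- c * real k)) * real n ^ l"
    by (intro mult_right_mono mult_left_mono) auto
  finally have "real (k choose l) * real ((n - l) choose (k - l)) * exp (a * real (l choose 2) + u * s)
     \<le> real (n choose k) * (exp (- a * real k / 8) + exp (- c * real k))"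
    using kn by simp
  then show thesis using that s_def by blast
next
  case False
  define r where "r = k - l"
  define s where "s = \<eta> * real r * real k"
  have kn: "real k > 0" "real n > 0" using l by auto
  have r: "real r = real k - real l" using l by (simp add: r_def of_nat_diff)
  have k_pow: "real (k choose l) \<le> exp (real r * ln (real k))"
  proof -
    have "(k choose l) \<le> k ^ r"
      using binomial_le_pow[of r k] l by (simp add: r_def binomial_symmetric[of l k])
    then have "real (k choose l) \<le> real k ^ r" by (simp flip: of_nat_power)
    then show ?thesis using kn by (simp add: exp_of_nat_mult)
  qed
  have n_pow: "real ((n - l) choose r) \<le> exp (real r * ln (real n))"
  proof -
    have "((n - l) choose r) \<le> (n - l) ^ r"
      using l by (intro binomial_le_pow) (simp add: r_def)
    also have "\<dots> \<le> n ^ r" by (intro power_mono) auto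
    finally have "real ((n - l) choose r) \<le> real n ^ r" by (simp flip: of_nat_power)
    then show ?thesis using kn by (simp add: exp_of_nat_mult)
  qed
  have "real (k choose l) * real ((n - l) choose (k - l)) * exp (a * real (l choose 2) + u * s)
    \<le> exp (real r * ln (real k)) * exp (real r * ln (real n)) * exp (a * real (l choose 2) + u * s)"
    using k_pow n_pow unfolding r_def[symmetric] by (intro mult_right_mono mult_mono) auto
  also have "\<dots> = exp (real r * ln (real k) + real r * ln (real n) + a * real (l choose 2) + u * s)"
    by (simp add: exp_add)
  also have "\<dots> \<le> exp (a * real (k choose 2))"
  proof -
    have "a * real (k choose 2) - a * real (l choose 2) = real r * (a * (real k + real l - 1) / 2)"
      unfolding r by (simp add: real_choose_two field_simps)
    moreover have "u * s = real r * (a * \<delta> * real k / 4)"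
      using pos by (simp add: s_def \<eta> field_simps)
    moreover have "ln (real k) + ln (real n) + a * \<delta> * real k / 4 \<le> a * (real k + real l - 1) / 2"
    proof -
      have "a * (\<delta> * real k) \<le> a * real l"
        using False pos by (intro mult_left_mono) auto
      then show ?thesis using ln_n big by (simp add: field_simps)
    qed
    then have "real r * (ln (real k) + ln (real n) + a * \<delta> * real k / 4) \<le> real r * (a * (real k + real l - 1) / 2)"
      by (intro mult_left_mono) auto
    moreover have "real r * (ln (real k) + ln (real n) + a * \<delta> * real k / 4) =
        real r * ln (real k) + real r * ln (real n) + real r * (a * \<delta> * real k / 4)"
      by (simp only: distrib_left)
    ultimately have "real r * ln (real k) + real r * ln (real n) + a * real (l choose 2) + u * s
        \<le> a * real (k choose 2)" by linarith
    then show ?thesis by simp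
  qed
  \<comment> \<open>For \<open>l = k\<close> no vertex is exchanged, so the decay has to come from
    \<open>E\<close>: the expected count grows like \<open>exp (c * k)\<close>.\<close>
  also have "\<dots> = exp (a * real (k choose 2) + c * real k) * exp (- c * real k)"
    by (simp flip: exp_add)
  also have "\<dots> \<le> real (n choose k) * exp (- c * real k)"
    using E by (intro mult_right_mono) auto
  also have "\<dots> \<le> real (n choose k) * (exp (- a * real k / 8) + exp (- c * real k))"
    by (intro mult_left_mono) auto
  finally show thesis using that[of s] by (simp add: s_def r_def)
qed

text \<open>Shows that balance depends on \<open>S \<inter> all_pairs V\<close> alone, the form in
  which independence is stated.\<close>

lemma balanced_Int_all_pairs: "balanced \<gamma> \<eta> V (S \<inter> all_pairs V) \<longleftrightarrow> balanced \<gamma> \<eta> V S"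
proof -
  have "S \<inter> all_pairs V \<inter> (all_pairs V - all_pairs I) = S \<inter> (all_pairs V - all_pairs I)" for I
    by auto
  then show ?thesis by (simp add: balanced_def Int_assoc)
qed

lemma all_pairs_card_le_1:
  assumes "finite I" "card I \<le> 1"
  shows "all_pairs I = {}"
proof (rule equals0I)
  fix e assume "e \<in> all_pairs I"
  then have e: "e \<subseteq> I" "card e = 2" by (simp_all add: all_pairs_def)
  show False using card_mono[OF assms(1) e(1)] e(2) assms(2) by linarith
qed

text \<open>Chebyshev's inequality for the number of balanced \<open>k\<close>-sets. Pairs with at
  most one common vertex are independent; the others are grouped by the size of the overlap, and
  \<open>B\<close> bounds the share of each size relative to the squared mean, up to the other
  factors in the conclusion.\<close>

lemma prob_no_balanced_le:
  fixes B :: real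
  assumes p\<gamma>: "0 < p" "p < \<gamma>" "\<gamma> < 1" and "\<eta> > 0"
    and N: "N = k choose 2" "1 \<le> \<gamma> * real N" and k: "1 \<le> k" "k \<le> n"
    and small: "(1 + exp (- 2 * \<eta>\<^sup>2 * real k)) ^ k - 1 \<le> 1 / (4 * (real N + 1))"
    and overlap: "\<And>l. 2 \<le> l \<Longrightarrow> l \<le> k \<Longrightarrow> \<exists>s. (s = real (l choose 2) \<or> s = \<eta> * real (k - l) * real k) \<and>
       real (k choose l) * real ((n - l) choose (k - l)) *
         exp (alpha \<gamma> p * real (l choose 2) + ln (\<gamma> * (1 - p) / (p * (1 - \<gamma>))) * s)
       \<le> real (n choose k) * B"
  shows "measure_pmf.prob (random_subset (all_pairs {1..n}) p)
      {S. \<forall>V. V \<subseteq> {1..n} \<and> card V = k \<longrightarrow> \<not> balanced \<gamma> \<eta> V S}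
    \<le> real k * exp (ln (\<gamma> * (1 - p) / (p * (1 - \<gamma>)))) * B * (4 * (real N + 1))\<^sup>2"
proof -
  define a where "a = alpha \<gamma> p"
  define u where "u = ln (\<gamma> * (1 - p) / (p * (1 - \<gamma>)))"
  define \<rho> where "\<rho> = tilt \<gamma> p N"
  \<comment> \<open>Half of the lower bound \<open>1 / (2 * (N + 1))\<close> for the exact edge
    count; by \<open>small\<close>, the union bound uses up at most the other half.\<close>
  define q where "q = 1 / (4 * (real N + 1))"
  define E where "E = all_pairs {1..n}"
  define Vs where "Vs = {V. V \<subseteq> {1..n} \<and> card V = k}"
  define F where "F V = {S. balanced \<gamma> \<eta> V S}" for V :: "nat set"
  let ?M = "random_subset E p"
  let ?P = "measure_pmf.prob ?M"
  have finE: "finite E" by (simp add: E_def finite_all_pairs)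
  have Vs: "finite Vs" "card Vs = n choose k"
    using n_subsets[of "{1..n}" k] by (auto simp: Vs_def)
  have VsD: "finite V" "all_pairs V \<subseteq> E" "card V = k" "V \<subseteq> {1..n}" if "V \<in> Vs" for V
    using that finite_subset[of V "{1..n}"] all_pairs_mono[of V "{1..n}"] by (auto simp: Vs_def E_def)
  have \<rho>: "\<rho> > 0" "exp (- a * real N) \<le> \<rho> * exp u"
    using tilt_pos[OF p\<gamma>, of N] tilt_ge[OF p\<gamma>, of N]
    by (auto simp: \<rho>_def a_def u_def exp_diff divide_le_eq)
  have q: "q > 0" by (simp add: q_def add_nonneg_pos)
  from overlap obtain s where s: "\<And>l. 2 \<le> l \<Longrightarrow> l \<le> k \<Longrightarrow> s l = real (l choose 2) \<or> s l = \<eta> * real (k - l) * real k"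
    "\<And>l. 2 \<le> l \<Longrightarrow> l \<le> k \<Longrightarrow> real (k choose l) * real ((n - l) choose (k - l)) *
         exp (a * real (l choose 2) + u * s l) \<le> real (n choose k) * B"
    unfolding a_def u_def by metis
  define g where "g l = \<rho> * exp (- a * (real N - real (l choose 2)) + u * s l)" for l
  have g: "g l \<ge> 0" for l using \<rho> by (simp add: g_def)
  have PF: "\<rho> * q \<le> ?P (F V)" if "V \<in> Vs" for V
  proof -
    have "q \<le> 1 / (2 * (real N + 1)) - ((1 + exp (- 2 * \<eta>\<^sup>2 * real k)) ^ k - 1)"
    proof -
      have "1 / (2 * (real N + 1)) = 2 * q" by (simp add: q_def field_simps)
      then show ?thesis using small unfolding q_def[symmetric] by linarith
    qed
    then have "\<rho> * q \<le> \<rho> * (1 / (2 * (real N + 1)) - ((1 + exp (- 2 * \<eta>\<^sup>2 * real k)) ^ k - 1))"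
      using \<rho> by (intro mult_left_mono) auto
    also have "\<dots> \<le> ?P (F V)"
      using prob_balanced_ge[OF finE VsD(2,1)[OF that] p\<gamma> \<open>\<eta> > 0\<close>, of N] N VsD(3)[OF that]
      by (simp add: F_def \<rho>_def)
    finally show ?thesis .
  qed
  have cov: "?P (F V \<inter> F W) - ?P (F V) * ?P (F W) \<le>
      (if card (V \<inter> W) \<in> {2..k} then g (card (V \<inter> W)) else 0)" if "V \<in> Vs" "W \<in> Vs" for V W
  proof (cases "card (V \<inter> W) \<in> {2..k}")
    case True
    have "?P (F V \<inter> F W) \<le> g (card (V \<inter> W))"
      unfolding F_def g_def \<rho>_def N(1) a_def u_def
      using True s(1) VsD[OF that(1)] VsD[OF that(2)] p\<gamma>
      by (intro prob_balanced_Int_le[OF finE]) auto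
    moreover have "0 \<le> ?P (F V) * ?P (F W)" by simp
    ultimately show ?thesis unfolding if_P[OF True] by linarith
  next
    \<comment> \<open>At most one common vertex means no common pair, so the covariance
      vanishes.\<close>
    case False
    have "card (V \<inter> W) \<le> k" using VsD[OF that(1)] by (metis card_mono Int_lower1)
    then have "all_pairs V \<inter> all_pairs W = {}"
      unfolding all_pairs_Int using False VsD[OF that(1)]
      by (intro all_pairs_card_le_1) auto
    moreover have "F V \<inter> F W = {S. balanced \<gamma> \<eta> V S \<and> balanced \<gamma> \<eta> W S}"
      by (auto simp: F_def)
    ultimately have "?P (F V \<inter> F W) = ?P (F V) * ?P (F W)"
      using prob_random_subset_indep[OF finE VsD(2)[OF that(1)] VsD(2)[OF that(2)],
        of p "balanced \<gamma> \<eta> V" "balanced \<gamma> \<eta> W"]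
      by (simp add: balanced_Int_all_pairs F_def)
    then show ?thesis unfolding if_not_P[OF False] by simp
  qed
  have row: "(\<Sum>W\<in>Vs. if card (V \<inter> W) \<in> {2..k} then g (card (V \<inter> W)) else 0) \<le>
      real k * (\<rho>\<^sup>2 * exp u * real (n choose k) * B)" if "V \<in> Vs" for V
  proof -
    have "(\<Sum>W\<in>Vs. if card (V \<inter> W) \<in> {2..k} then g (card (V \<inter> W)) else 0) =
        (\<Sum>W | W \<in> Vs \<and> card (V \<inter> W) \<in> {2..k}. g (card (V \<inter> W)))"
      using Vs by (simp add: sum.inter_filter)
    also have "\<dots> = (\<Sum>l\<in>{2..k}. \<Sum>W | W \<in> {W \<in> Vs. card (V \<inter> W) \<in> {2..k}} \<and> card (V \<inter> W) = l.
        g (card (V \<inter> W)))"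
      by (rule sum.group[symmetric]) (use Vs in auto)
    also have "\<dots> \<le> (\<Sum>l\<in>{2..k}. \<rho>\<^sup>2 * exp u * real (n choose k) * B)"
    proof (rule sum_mono)
      fix l assume l: "l \<in> {2..k}"
      let ?X = "{W. W \<in> {W \<in> Vs. card (V \<inter> W) \<in> {2..k}} \<and> card (V \<inter> W) = l}"
      have "?X \<subseteq> {W. W \<subseteq> {1..n} \<and> card W = k \<and> card (V \<inter> W) = l}"
        by (auto simp: Vs_def)
      then have "card ?X \<le> card {W. W \<subseteq> {1..n} \<and> card W = k \<and> card (V \<inter> W) = l}"
        by (intro card_mono) auto
      also have "\<dots> \<le> (k choose l) * ((n - l) choose (k - l))"
        using card_sets_with_Int_le[of "{1..n}" V k l] VsD[OF that] l by simp
      finally have X: "real (card ?X) \<le> real (k choose l) * real ((n - l) choose (k - l))"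
        by (simp flip: of_nat_mult)
      have "(\<Sum>W\<in>?X. g (card (V \<inter> W))) = real (card ?X) * g l" by simp
      also have "\<dots> \<le> real (k choose l) * real ((n - l) choose (k - l)) * g l"
        using X g by (intro mult_right_mono) auto
      also have "\<dots> = \<rho> * exp (- a * real N) * (real (k choose l) * real ((n - l) choose (k - l)) *
         exp (a * real (l choose 2) + u * s l))"
        by (simp add: g_def algebra_simps flip: exp_add)
      also have "\<dots> \<le> \<rho> * exp (- a * real N) * (real (n choose k) * B)"
        using s(2)[of l] l \<rho> by (intro mult_left_mono) auto
      \<comment> \<open>Trading \<open>exp (- a * N)\<close> for \<open>\<rho> * exp u\<close> lets
        the square of \<rho> cancel against the squared mean.\<close>
      also have "\<dots> \<le> \<rho> * (\<rho> * exp u) * (real (n choose k) * B)"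
      proof (intro mult_right_mono mult_left_mono \<rho>(2))
        have "0 \<le> real (k choose l) * real ((n - l) choose (k - l)) * exp (a * real (l choose 2) + u * s l)"
          by simp
        also have "\<dots> \<le> real (n choose k) * B" using s(2)[of l] l by simp
        finally show "0 \<le> real (n choose k) * B" .
      qed (use \<rho> in auto)
      finally show "(\<Sum>W\<in>?X. g (card (V \<inter> W))) \<le> \<rho>\<^sup>2 * exp u * real (n choose k) * B"
        by (simp add: power2_eq_square mult_ac)
    qed
    also have "\<dots> = real (k - 1) * (\<rho>\<^sup>2 * exp u * real (n choose k) * B)"
      by (cases k) auto
    \<comment> \<open>The summand is nonnegative by \<open>overlap\<close> at \<open>l = 2\<close>;
      \<open>1 \<le> \<gamma> * N\<close> rules out \<open>k < 2\<close>.\<close>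
    also have "\<dots> \<le> real k * (\<rho>\<^sup>2 * exp u * real (n choose k) * B)"
    proof (cases "k \<ge> 2")
      case True
      have "0 \<le> real (k choose 2) * real ((n - 2) choose (k - 2)) * exp (a * real (2 choose 2) + u * s 2)"
        by simp
      also have "\<dots> \<le> real (n choose k) * B" using s(2)[of 2] True by simp
      finally have "0 \<le> real (n choose k) * B" .
      then have "0 \<le> \<rho>\<^sup>2 * exp u * (real (n choose k) * B)"
        by (rule mult_nonneg_nonneg[rotated]) simp
      then show ?thesis by (intro mult_right_mono) (simp_all only: mult.assoc of_nat_le_iff diff_le_self)
    next
      case False
      then have "N = 0" by (simp add: N(1) binomial_eq_0)
      then show ?thesis using N(2) by simp
    qed
    finally show ?thesis .
  qed
  let ?Z = "?P {S. \<forall>V. V \<subseteq> {1..n} \<and> card V = k \<longrightarrow> \<not> balanced \<gamma> \<eta> V S}"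
  have "?Z * (real (n choose k) * (\<rho> * q))\<^sup>2 \<le> ?Z * (\<Sum>V\<in>Vs. ?P (F V))\<^sup>2"
  proof (intro mult_left_mono power_mono)
    have "real (n choose k) * (\<rho> * q) = (\<Sum>V\<in>Vs. \<rho> * q)" using Vs by simp
    also have "\<dots> \<le> (\<Sum>V\<in>Vs. ?P (F V))" by (intro sum_mono PF)
    finally show "real (n choose k) * (\<rho> * q) \<le> (\<Sum>V\<in>Vs. ?P (F V))" .
  qed (use \<rho> q in auto)
  also have "\<dots> \<le> (\<Sum>V\<in>Vs. \<Sum>W\<in>Vs. ?P (F V \<inter> F W) - ?P (F V) * ?P (F W))"
    using measure_pmf.second_moment_prob_zero[of Vs F ?M] Vs by (simp add: Vs_def F_def)
  also have "\<dots> \<le> (\<Sum>V\<in>Vs. \<Sum>W\<in>Vs. if card (V \<inter> W) \<in> {2..k} then g (card (V \<inter> W)) else 0)"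
    by (intro sum_mono cov)
  also have "\<dots> \<le> (\<Sum>V\<in>Vs. real k * (\<rho>\<^sup>2 * exp u * real (n choose k) * B))"
    by (intro sum_mono row)
  also have "\<dots> = real (n choose k) * (real k * (\<rho>\<^sup>2 * exp u * real (n choose k) * B))"
    using Vs by simp
  also have "\<dots> = (real k * exp u * B * (1 / q)\<^sup>2) * (real (n choose k) * (\<rho> * q))\<^sup>2"
    using q by (simp add: power2_eq_square field_simps)
  finally have "?Z * (real (n choose k) * (\<rho> * q))\<^sup>2 \<le>
     (real k * exp u * B * (1 / q)\<^sup>2) * (real (n choose k) * (\<rho> * q))\<^sup>2" .
  moreover have "0 < (real (n choose k) * (\<rho> * q))\<^sup>2"
    using k \<rho> q by (intro zero_less_power mult_pos_pos) auto
  ultimately have "?Z \<le> real k * exp u * B * (1 / q)\<^sup>2"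
    by (simp only: mult_le_cancel_right_pos)
  then show ?thesis by (simp add: q_def u_def E_def)
qed

section \<open>From vertex sets to the quasi-clique number\<close>

text \<open>A balanced \<open>k\<close>-set spans at least \<open>\<gamma> * (k choose 2)\<close>
  edges and thus carries a quasi-clique.\<close>

lemma prob_quasi_clique_number_less:
  assumes "\<gamma> \<ge> 0"
  shows "measure_pmf.prob (random_graph n p) {G. quasi_clique_number \<gamma> G < k} \<le>
    measure_pmf.prob (random_subset (all_pairs {1..n}) p)
      {S. \<forall>V. V \<subseteq> {1..n} \<and> card V = k \<longrightarrow> \<not> balanced \<gamma> \<eta> V S}"
  unfolding random_graph_eq measure_map_pmf vimage_Collect_eq
proof (rule measure_pmf.finite_measure_mono_AE, rule AE_pmfI, intro impI CollectI allI notI, elim conjE CollectE)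
  fix S V assume "S \<in> set_pmf (random_subset (all_pairs {1..n}) p)"
    and less: "quasi_clique_number \<gamma> ({1..n}, S) < k"
    and V: "V \<subseteq> {1..n}" "card V = k" and bal: "balanced \<gamma> \<eta> V S"
  then have S: "S \<subseteq> all_pairs {1..n}" using set_pmf_random_subset by blast
  have "\<gamma> * real (card V choose 2) \<le> real (card (S \<inter> all_pairs V))"
    using bal unfolding balanced_def by linarith
  then have "card V \<le> quasi_clique_number \<gamma> ({1..n}, S)"
    using V S by (intro le_quasi_clique_number) auto
  then show False using less V by simp
qed simp

text \<open>Union bound over all vertex sets with at least \<open>t\<close> elements, one of which
  carries a largest quasi-clique; each is treated by the Chernoff bound with
  \<open>s = 0\<close>.\<close>

lemma prob_quasi_clique_number_ge:
  fixes t :: real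
  assumes p\<gamma>: "0 < p" "p < \<gamma>" "\<gamma> < 1"
  shows "measure_pmf.prob (random_graph n p) {G. t \<le> real (quasi_clique_number \<gamma> G)} \<le>
    (\<Sum>m | m \<le> n \<and> t \<le> real m. real (n choose m) * exp (- alpha \<gamma> p * real (m choose 2)))"
proof -
  define E where "E = all_pairs {1..n}"
  define Q where "Q A = {S. \<gamma> * real (card A choose 2) \<le> real (card (S \<inter> all_pairs A))}" for A :: "nat set"
  let ?P = "measure_pmf.prob (random_subset E p)"
  have finE: "finite E" by (simp add: E_def finite_all_pairs)
  have Q: "?P (Q A) \<le> exp (- alpha \<gamma> p * real (card A choose 2))" if "A \<subseteq> {1..n}" for A
  proof -
    have "finite A" using that finite_subset by auto
    then have "?P (Q A) = measure_pmf.prob (binomial_pmf (card A choose 2) p)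
        {i. \<gamma> * real (card A choose 2) \<le> real i}"
      unfolding Q_def using p\<gamma> that finE
      by (subst prob_random_subset_card) (auto simp: E_def all_pairs_mono card_all_pairs)
    also have "\<dots> \<le> exp (- alpha \<gamma> p * real (card A choose 2))"
      using binomial_tail_exp_le[OF p\<gamma>, of "card A choose 2" 0] by simp
    finally show ?thesis .
  qed
  have "measure_pmf.prob (random_graph n p) {G. t \<le> real (quasi_clique_number \<gamma> G)} =
      ?P {S. t \<le> real (quasi_clique_number \<gamma> ({1..n}, S))}"
    unfolding random_graph_eq measure_map_pmf vimage_Collect_eq E_def ..
  also have "\<dots> \<le> ?P (\<Union>m\<in>{m. m \<le> n \<and> t \<le> real m}. \<Union>A\<in>{A. A \<subseteq> {1..n} \<and> card A = m}. Q A)"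
  proof (rule measure_pmf.finite_measure_mono_AE, rule AE_pmfI, rule impI)
    fix S assume "S \<in> set_pmf (random_subset E p)" and "S \<in> {S. t \<le> real (quasi_clique_number \<gamma> ({1..n}, S))}"
    then have S: "S \<subseteq> all_pairs {1..n}" "t \<le> real (quasi_clique_number \<gamma> ({1..n}, S))"
      using set_pmf_random_subset[of E p] by (auto simp: E_def)
    obtain A where A: "A \<subseteq> {1..n}" "card A = quasi_clique_number \<gamma> ({1..n}, S)"
      "\<gamma> * real (card A choose 2) \<le> real (card (S \<inter> all_pairs A))"
      using quasi_clique_number_attained[OF _ S(1)] by blast
    moreover have "card A \<le> n" using card_mono[OF _ A(1)] by simp
    ultimately show "S \<in> (\<Union>m\<in>{m. m \<le> n \<and> t \<le> real m}. \<Union>A\<in>{A. A \<subseteq> {1..n} \<and> card A = m}. Q A)"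
      using S by (auto simp: Q_def)
  qed simp
  also have "\<dots> \<le> (\<Sum>m | m \<le> n \<and> t \<le> real m. ?P (\<Union>A\<in>{A. A \<subseteq> {1..n} \<and> card A = m}. Q A))"
    by (intro measure_pmf.finite_measure_subadditive_finite) auto
  also have "\<dots> \<le> (\<Sum>m | m \<le> n \<and> t \<le> real m. real (n choose m) * exp (- alpha \<gamma> p * real (m choose 2)))"
  proof (rule sum_mono)
    fix m
    have "?P (\<Union>A\<in>{A. A \<subseteq> {1..n} \<and> card A = m}. Q A) \<le> (\<Sum>A | A \<subseteq> {1..n} \<and> card A = m. ?P (Q A))"
      by (intro measure_pmf.finite_measure_subadditive_finite) auto
    also have "\<dots> \<le> (\<Sum>A | A \<subseteq> {1..n} \<and> card A = m. exp (- alpha \<gamma> p * real (m choose 2)))"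
      using Q by (intro sum_mono) auto
    also have "\<dots> = real (n choose m) * exp (- alpha \<gamma> p * real (m choose 2))"
      using n_subsets[of "{1..n}" m] by simp
    finally show "?P (\<Union>A\<in>{A. A \<subseteq> {1..n} \<and> card A = m}. Q A) \<le>
       real (n choose m) * exp (- alpha \<gamma> p * real (m choose 2))" .
  qed
  finally show ?thesis .
qed

subsection \<open>Concentration\<close>

lemma quasi_clique_number_le_tendsto_0:
  fixes p \<gamma> \<epsilon> :: real
  assumes p\<gamma>: "0 < p" "p < \<gamma>" "\<gamma> < 1" and \<epsilon>: "\<epsilon> > 0"
  shows "((\<lambda>n. measure_pmf.prob (random_graph n p)
    {G. real (quasi_clique_number \<gamma> G) \<le> quasi_clique_location \<gamma> p n - \<epsilon>}) \<longlongrightarrow> 0) sequentially"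
proof -
  define a where "a = alpha \<gamma> p"
  define u where "u = ln (\<gamma> * (1 - p) / (p * (1 - \<gamma>)))"
  define \<delta> where "\<delta> = a / (2 * (a + u))"
  define \<eta> where "\<eta> = a * \<delta> / (4 * u)"
  \<comment> \<open>The exponent per vertex eventually exceeds
    \<open>a * \<epsilon> / 4 = 2 * c\<close>: one \<open>c\<close> remains as growth of the
    expected count, the other pays for \<open>ln k + 2\<close>.\<close>
  define c where "c = a * \<epsilon> / 8"
  define L where "L = quasi_clique_location \<gamma> p"
  \<comment> \<open>The least integer strictly above \<open>L n - \<epsilon>\<close>, once that
    number is nonnegative.\<close>
  define k where "k n = nat (\<lfloor>L n - \<epsilon>\<rfloor> + 1)" for n
  define B where "B k = exp (- a * real k / 8) + exp (- c * real k)" for k :: nat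
  have "p * (1 - \<gamma>) < \<gamma> * (1 - p)" using p\<gamma> by (simp add: algebra_simps)
  then have u: "u > 0" using p\<gamma> by (simp add: u_def)
  have a: "a > 0" unfolding a_def using alpha_pos[OF p\<gamma>] .
  have \<delta>: "\<delta> > 0" using a u by (simp add: \<delta>_def)
  have \<eta>: "\<eta> > 0" using a u \<delta> by (simp add: \<eta>_def)
  have c: "c > 0" using a \<epsilon> by (simp add: c_def)
  have \<gamma>0: "\<gamma> > 0" using p\<gamma> by simp
  note asymp = quasi_clique_location_asymp[OF p\<gamma>, folded a_def L_def]
  have k_top: "filterlim k at_top sequentially"
  proof -
    have "filterlim (\<lambda>n. real (k n)) at_top sequentially"
    proof (rule filterlim_at_top_mono)
      show "filterlim (\<lambda>n. - \<epsilon> + L n) at_top sequentially"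
        by (rule filterlim_tendsto_add_at_top[OF tendsto_const asymp(1)])
      show "\<forall>\<^sub>F n in sequentially. - \<epsilon> + L n \<le> real (k n)"
        unfolding k_def by (intro always_eventually allI) linarith
    qed
    then show ?thesis by (simp add: filterlim_sequentially_iff_filterlim_real)
  qed
  \<comment> \<open>All conditions that hold for large \<open>k\<close> alone, to be transported
    along \<open>k_top\<close>.\<close>
  have big: "eventually (\<lambda>k::nat. 1 \<le> k \<and> 1 \<le> \<gamma> * (real k * (real k - 1) / 2) \<and>
      8 * real k ^ 3 * exp (- 2 * \<eta>\<^sup>2 * real k) \<le> 1 \<and>
      2 * ln (real k) + a / 2 \<le> a * real k / 8 \<and> 3 * ln (real k) + a / 2 \<le> a * \<delta> * real k / 4 \<and>
      ln (real k) + 2 \<le> c * real k) at_top"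
    using a \<delta> \<eta> c \<gamma>0 by (intro eventually_conj eventually_ge_at_top) real_asymp+
  have lim: "((\<lambda>k::nat. 16 * exp u * real k ^ 5 * B k) \<longlongrightarrow> 0) at_top"
  proof -
    have "((\<lambda>k::nat. 16 * exp u * real k ^ 5 * exp (- a * real k / 8)) \<longlongrightarrow> 0) at_top"
      using a by real_asymp
    moreover have "((\<lambda>k::nat. 16 * exp u * real k ^ 5 * exp (- c * real k)) \<longlongrightarrow> 0) at_top"
      using c by real_asymp
    ultimately show ?thesis
      unfolding B_def distrib_left by (rule tendsto_add_zero)
  qed
  \<comment> \<open>The shifts reflect \<open>k \<le> L + 1\<close> inside the logarithm and
    \<open>k - 1 \<le> L - \<epsilon>\<close> in the linear term.\<close>
  have "eventually (\<lambda>n. ln (real n) + 1 - ln (L n + 1) - a * (L n + - \<epsilon>) / 2 > a * \<epsilon> / 4) sequentially"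
    using asymp(2)[of 1 "- \<epsilon>"] by (rule order_tendstoD) (use a \<epsilon> in simp)
  moreover have "eventually (\<lambda>n. L n \<ge> \<epsilon> + 1) sequentially"
    using asymp(1) by (auto simp: filterlim_at_top)
  ultimately have "eventually (\<lambda>n. measure_pmf.prob (random_graph n p)
      {G. real (quasi_clique_number \<gamma> G) \<le> L n - \<epsilon>} \<le> 16 * exp u * real (k n) ^ 5 * B (k n)) sequentially"
    using eventually_compose_filterlim[OF big k_top] asymp(3)[of 1] asymp(4)[of "- \<epsilon>" "- \<epsilon>"] asymp(5)[of "- \<epsilon>"]
  proof eventually_elim
    case (elim n)
    define K where "K = k n"
    define N where "N = K choose 2"
    have K: "L n - \<epsilon> < real K" "real K \<le> L n - \<epsilon> + 1" using elim(2) by (auto simp: K_def k_def; linarith)+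
    have bigK: "1 \<le> K" "1 \<le> \<gamma> * real N" "8 * real K ^ 3 * exp (- 2 * \<eta>\<^sup>2 * real K) \<le> 1"
      "2 * ln (real K) + a / 2 \<le> a * real K / 8" "3 * ln (real K) + a / 2 \<le> a * \<delta> * real K / 4"
      "ln (real K) + 2 \<le> c * real K"
      using elim(3) by (auto simp: K_def N_def real_choose_two)
    have "(real K)\<^sup>2 \<le> (L n + 1)\<^sup>2" using K \<epsilon> by (intro power_mono) auto
    then have Kn2: "2 * (real K)\<^sup>2 \<le> real n" using elim(4) by linarith
    have "real K \<le> (real K)\<^sup>2" using bigK(1) by (simp add: power2_eq_square)
    then have Kn: "K \<le> n" using Kn2 by linarith
    have N: "real N + 1 \<le> (real K)\<^sup>2"
    proof -
      have "2 \<le> real K + (real K)\<^sup>2" using bigK(1) \<open>real K \<le> (real K)\<^sup>2\<close> by linarith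
      then show ?thesis by (simp add: N_def real_choose_two power2_eq_square field_simps)
    qed
    have aK: "a * (real K - 1) / 2 \<le> a * (L n - \<epsilon>) / 2"
      using K a by (intro divide_right_mono mult_left_mono) auto
    have ln_n: "a * (real K - 1) / 2 \<le> ln (real n)" "ln (real n) \<le> a * real K / 2 + 2 * ln (real K)"
    proof -
      have "ln (L n - \<epsilon>) \<le> ln (real K)" using K elim(2) by (subst ln_le_cancel_iff) auto
      moreover have "a * (L n - \<epsilon>) / 2 \<le> a * real K / 2"
        using K a by (intro divide_right_mono mult_left_mono) auto
      ultimately show "ln (real n) \<le> a * real K / 2 + 2 * ln (real K)" using elim(5) by simp
      show "a * (real K - 1) / 2 \<le> ln (real n)" using aK elim(6) by simp
    qed
    have "exp (a * real N + c * real K) \<le>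
      exp (real K * (ln (real n) + 1 - ln (real K)) - ln (real K) - 2)"
    proof -
      have "ln (real K) \<le> ln (L n + 1)" using K \<epsilon> bigK(1) by (subst ln_le_cancel_iff) auto
      then have "a * \<epsilon> / 4 \<le> ln (real n) + 1 - ln (real K) - a * (real K - 1) / 2"
        using elim(1) aK by simp
      then have "real K * (a * \<epsilon> / 4) \<le> real K * (ln (real n) + 1 - ln (real K) - a * (real K - 1) / 2)"
        by (intro mult_left_mono) auto
      also have "\<dots> = real K * (ln (real n) + 1 - ln (real K)) - a * real N"
        by (simp add: N_def real_choose_two algebra_simps)
      finally show ?thesis using bigK(6) by (simp add: c_def algebra_simps)
    qed
    also have "\<dots> \<le> real (n choose K)"
      using bigK Kn2 by (intro binomial_ge_exp) auto
    finally have E: "exp (a * real N + c * real K) \<le> real (n choose K)" .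
    \<comment> \<open>From \<open>1 + x \<le> exp x\<close> and a quadratic bound on
      \<open>exp\<close>, the excess is at most \<open>2 * K * x\<close>; then
      \<open>N + 1 \<le> K^2\<close> and \<open>8 * K^3 * x \<le> 1\<close> finish.\<close>
    have small: "(1 + exp (- 2 * \<eta>\<^sup>2 * real K)) ^ K - 1 \<le> 1 / (4 * (real N + 1))"
    proof -
      define x where "x = exp (- 2 * \<eta>\<^sup>2 * real K)"
      have x: "x > 0" "8 * real K ^ 3 * x \<le> 1" using bigK by (auto simp: x_def)
      have Kx: "8 * (real K)\<^sup>2 * (real K * x) \<le> 1"
        using x by (simp add: power2_eq_square power3_eq_cube mult_ac)
      have "1 \<le> (real K)\<^sup>2" using bigK(1) by simp
      then have "1 * (real K * x) \<le> 8 * (real K)\<^sup>2 * (real K * x)"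
        using x by (intro mult_right_mono) auto
      then have Kx1: "real K * x \<le> 1" using Kx by linarith
      have "(1 + x) ^ K \<le> exp x ^ K" using x by (intro power_mono) auto
      also have "\<dots> = exp (real K * x)" by (simp add: exp_of_nat_mult)
      also have "\<dots> \<le> 1 + real K * x + (real K * x)\<^sup>2"
        using Kx1 x by (intro exp_bound) auto
      also have "\<dots> \<le> 1 + 2 * (real K * x)"
      proof -
        have "(real K * x) * (real K * x) \<le> 1 * (real K * x)"
          using Kx1 x by (intro mult_right_mono) auto
        then show ?thesis unfolding power2_eq_square by linarith
      qed
      finally have "(1 + x) ^ K - 1 \<le> 2 * (real K * x)" by simp
      also have "\<dots> \<le> 1 / (4 * (real N + 1))"
      proof -
        have "8 * (real N + 1) * (real K * x) \<le> 8 * (real K)\<^sup>2 * (real K * x)"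
          using N x by (intro mult_right_mono) auto
        then show ?thesis using Kx by (simp add: field_simps)
      qed
      finally show ?thesis by (simp add: x_def)
    qed
    have "measure_pmf.prob (random_graph n p) {G. real (quasi_clique_number \<gamma> G) \<le> L n - \<epsilon>} \<le>
        measure_pmf.prob (random_graph n p) {G. quasi_clique_number \<gamma> G < K}"
      using K by (intro measure_pmf.finite_measure_mono) auto
    also have "\<dots> \<le> measure_pmf.prob (random_subset (all_pairs {1..n}) p)
      {S. \<forall>V. V \<subseteq> {1..n} \<and> card V = K \<longrightarrow> \<not> balanced \<gamma> \<eta> V S}"
      using p\<gamma> by (intro prob_quasi_clique_number_less) auto
    also have "\<dots> \<le> real K * exp (ln (\<gamma> * (1 - p) / (p * (1 - \<gamma>)))) * B K * (4 * (real N + 1))\<^sup>2"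
    proof (rule prob_no_balanced_le[OF p\<gamma> \<eta> N_def bigK(2,1) Kn small], fold a_def u_def)
      fix l assume l: "2 \<le> l" "l \<le> K"
      obtain s where "s = real (l choose 2) \<or> s = \<eta> * real (K - l) * real K"
        "real (K choose l) * real ((n - l) choose (K - l)) * exp (a * real (l choose 2) + u * s) \<le>
         real (n choose K) * (exp (- a * real K / 8) + exp (- c * real K))"
        using overlap_term_le[OF a u c \<delta>_def \<eta>_def l Kn E[unfolded N_def] ln_n bigK(4,5)] by blast
      then show "\<exists>s. (s = real (l choose 2) \<or> s = \<eta> * real (K - l) * real K) \<and>
        real (K choose l) * real ((n - l) choose (K - l)) * exp (a * real (l choose 2) + u * s)
        \<le> real (n choose K) * B K"
        unfolding B_def by blast
    qed
    also have "\<dots> = exp u * (real K * B K) * (4 * (real N + 1))\<^sup>2" by (simp add: u_def)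
    also have "\<dots> \<le> exp u * (real K * B K) * (4 * (real K)\<^sup>2)\<^sup>2"
      using N by (intro mult_left_mono power_mono) (auto simp: B_def)
    also have "\<dots> = 16 * exp u * real K ^ 5 * B K"
      by (simp add: power2_eq_square eval_nat_numeral)
    finally show ?case by (simp add: K_def)
  qed
  then show ?thesis
    unfolding L_def[symmetric]
    by (rule tendsto_sandwich[OF always_eventually _ tendsto_const filterlim_compose[OF lim k_top], rotated])
       simp
qed

text \<open>The exponent per vertex, \<open>ln n + 1 - ln m - a * (m - 1) / 2\<close>, decreases in
  \<open>m\<close>, and for large \<open>n\<close> it is below \<open>- 2 * c\<close> from
  \<open>t = L + 1 + \<epsilon>\<close> on. One \<open>c\<close> gives the vanishing factor
  \<open>exp (- c * t)\<close>, the other a convergent geometric series.\<close>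

lemma quasi_clique_number_ge_tendsto_0:
  fixes p \<gamma> \<epsilon> :: real
  assumes p\<gamma>: "0 < p" "p < \<gamma>" "\<gamma> < 1" and \<epsilon>: "\<epsilon> > 0"
  shows "((\<lambda>n. measure_pmf.prob (random_graph n p)
    {G. quasi_clique_location \<gamma> p n + 1 + \<epsilon> \<le> real (quasi_clique_number \<gamma> G)}) \<longlongrightarrow> 0) sequentially"
proof -
  define a where "a = alpha \<gamma> p"
  define L where "L = quasi_clique_location \<gamma> p"
  define c where "c = a * \<epsilon> / 8"
  have a: "a > 0" unfolding a_def using alpha_pos[OF p\<gamma>] .
  have c: "c > 0" using a \<epsilon> by (simp add: c_def)
  define w where "w = exp (- c)"
  have w: "0 < w" "w < 1" using c by (auto simp: w_def)
  note asymp = quasi_clique_location_asymp[OF p\<gamma>, folded a_def L_def]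
  have "eventually (\<lambda>n. ln (real n) + 1 - ln (L n + (1 + \<epsilon>)) - a * (L n + \<epsilon>) / 2 < - 2 * c) sequentially"
    using asymp(2)[of "1 + \<epsilon>" "\<epsilon>"] by (rule order_tendstoD) (use a \<epsilon> in \<open>simp add: c_def\<close>)
  moreover have "eventually (\<lambda>n. L n \<ge> 0) sequentially"
    using asymp(1) by (auto simp: filterlim_at_top)
  ultimately have "eventually (\<lambda>n. measure_pmf.prob (random_graph n p)
      {G. L n + 1 + \<epsilon> \<le> real (quasi_clique_number \<gamma> G)} \<le> exp (- c * (L n + 1 + \<epsilon>)) / (1 - w)) sequentially"
  proof eventually_elim
    case (elim n)
    define t where "t = L n + 1 + \<epsilon>"
    have "measure_pmf.prob (random_graph n p) {G. t \<le> real (quasi_clique_number \<gamma> G)} \<le>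
      (\<Sum>m | m \<le> n \<and> t \<le> real m. real (n choose m) * exp (- a * real (m choose 2)))"
      unfolding a_def by (rule prob_quasi_clique_number_ge[OF p\<gamma>])
    also have "\<dots> \<le> (\<Sum>m | m \<le> n \<and> t \<le> real m. exp (- c * t) * w ^ m)"
    proof (rule sum_mono)
      fix m assume "m \<in> {m. m \<le> n \<and> t \<le> real m}"
      then have m: "m \<le> n" "t \<le> real m" "0 < m" using elim(2) \<epsilon> by (auto simp: t_def intro: Nat.gr0I)
      have "ln t \<le> ln (real m)" using m elim(2) \<epsilon> by (subst ln_le_cancel_iff) (auto simp: t_def)
      moreover have "a * (L n + \<epsilon>) / 2 \<le> a * (real m - 1) / 2"
        using m a by (intro divide_right_mono mult_left_mono) (auto simp: t_def)
      moreover have "L n + (1 + \<epsilon>) = t" by (simp add: t_def)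
      ultimately have "ln (real n) + 1 - ln (real m) - a * (real m - 1) / 2 \<le> - 2 * c"
        using elim(1) by simp
      then have "real m * (ln (real n) + 1 - ln (real m) - a * (real m - 1) / 2) \<le> real m * (- 2 * c)"
        by (intro mult_left_mono) auto
      also have "\<dots> \<le> - c * t - c * real m" using m c by (simp add: algebra_simps)
      finally have le: "real m * (ln (real n) + 1 - ln (real m)) - a * real (m choose 2) \<le> - c * t - c * real m"
        by (simp add: real_choose_two algebra_simps)
      have "real (n choose m) * exp (- a * real (m choose 2)) \<le>
        exp (real m * (ln (real n) + 1 - ln (real m))) * exp (- a * real (m choose 2))"
        using m by (intro mult_right_mono binomial_le_exp) auto
      also have "\<dots> \<le> exp (- c * t - c * real m)"
        using le by (simp flip: exp_add)
      also have "\<dots> = exp (- c * t) * w ^ m"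
        unfolding w_def exp_of_nat2_mult[symmetric] exp_add[symmetric] by simp
      finally show "real (n choose m) * exp (- a * real (m choose 2)) \<le> exp (- c * t) * w ^ m" .
    qed
    also have "\<dots> \<le> (\<Sum>m\<le>n. exp (- c * t) * w ^ m)"
      using w by (intro sum_mono2) auto
    also have "\<dots> = exp (- c * t) * (\<Sum>m\<le>n. w ^ m)" by (simp add: sum_distrib_left)
    also have "\<dots> \<le> exp (- c * t) * (1 / (1 - w))"
    proof (rule mult_left_mono)
      have "(\<Sum>m\<le>n. w ^ m) \<le> (\<Sum>m. w ^ m)"
        using w by (intro sum_le_suminf summable_geometric) auto
      then show "(\<Sum>m\<le>n. w ^ m) \<le> 1 / (1 - w)" using w by (simp add: suminf_geometric)
    qed simp
    finally show ?case by (simp add: t_def)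
  qed
  moreover have "((\<lambda>n. exp (- c * (L n + 1 + \<epsilon>)) / (1 - w)) \<longlongrightarrow> 0) sequentially"
  proof -
    have "((\<lambda>x. exp (- c * (x + 1 + \<epsilon>)) / (1 - w)) \<longlongrightarrow> 0) at_top"
      using c w by real_asymp
    then show ?thesis by (rule filterlim_compose) (rule asymp(1))
  qed
  ultimately show ?thesis
    unfolding L_def[symmetric]
    by (rule tendsto_sandwich[OF always_eventually _ tendsto_const, rotated]) simp
qed

lemma quasi_clique_number_concentration:
  fixes p \<gamma> \<epsilon> :: real
  assumes p\<gamma>: "0 < p" "p < \<gamma>" "\<gamma> < 1" and \<epsilon>: "\<epsilon> > 0"
  shows "((\<lambda>n. measure_pmf.prob (random_graph n p)
            {G. real (quasi_clique_number \<gamma> G) - quasi_clique_location \<gamma> p n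
                  \<in> {-\<epsilon><..<1 + \<epsilon>}}) \<longlonglongrightarrow> 1)"
proof -
  let ?lo = "\<lambda>n. {G :: nat graph. real (quasi_clique_number \<gamma> G) \<le> quasi_clique_location \<gamma> p n - \<epsilon>}"
  let ?hi = "\<lambda>n. {G :: nat graph. quasi_clique_location \<gamma> p n + 1 + \<epsilon> \<le> real (quasi_clique_number \<gamma> G)}"
  let ?P = "\<lambda>n. measure_pmf.prob (random_graph n p)"
  have lim: "((\<lambda>n. 1 - (?P n (?lo n) + ?P n (?hi n))) \<longlongrightarrow> 1 - (0 + 0)) sequentially"
    by (intro tendsto_intros quasi_clique_number_le_tendsto_0 quasi_clique_number_ge_tendsto_0 assms)
  have le: "1 - (?P n (?lo n) + ?P n (?hi n)) \<le>
     ?P n {G. real (quasi_clique_number \<gamma> G) - quasi_clique_location \<gamma> p n \<in> {-\<epsilon><..<1 + \<epsilon>}}" for n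
  proof -
    let ?X = "{G. real (quasi_clique_number \<gamma> G) - quasi_clique_location \<gamma> p n \<in> {-\<epsilon><..<1 + \<epsilon>}}"
    have "1 - ?P n ?X = ?P n (- ?X)"
      using measure_pmf.prob_compl[of ?X "random_graph n p"] by (simp add: Compl_eq_Diff_UNIV)
    also have "\<dots> \<le> ?P n (?lo n \<union> ?hi n)"
      by (intro measure_pmf.finite_measure_mono) auto
    also have "\<dots> \<le> ?P n (?lo n) + ?P n (?hi n)"
      by (intro measure_Un_le) auto
    finally show ?thesis by linarith
  qed
  show ?thesis
  proof (rule tendsto_sandwich[OF always_eventually always_eventually _ tendsto_const])
    show "((\<lambda>n. 1 - (?P n (?lo n) + ?P n (?hi n))) \<longlongrightarrow> 1) sequentially"
      using lim by simp
  qed (use le in \<open>auto intro: measure_pmf.prob_le_1\<close>)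
qed

section \<open>The two closest integers\<close>

text \<open>Otherwise \<open>i\<close> and the two members of \<open>S\<close>, which are no farther
  from \<open>y\<close>, would be three distinct integers in an open interval of length 3/2.\<close>

lemma two_closest_integers_mem:
  assumes "two_closest_integers S y" "\<bar>of_int i - y\<bar> < 3 / 4"
  shows "i \<in> S"
proof (rule ccontr)
  assume i: "i \<notin> S"
  obtain j l where S: "S = {j, l}" "j \<noteq> l"
    using assms(1) unfolding two_closest_integers_def card_2_iff by blast
  have "\<bar>of_int j - y\<bar> \<le> \<bar>of_int i - y\<bar>" "\<bar>of_int l - y\<bar> \<le> \<bar>of_int i - y\<bar>"
    using assms(1) i unfolding two_closest_integers_def S by blast+
  then have "\<bar>real_of_int (j - i)\<bar> < 2" "\<bar>real_of_int (l - i)\<bar> < 2" "\<bar>real_of_int (j - l)\<bar> < 2"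
    using assms(2) by linarith+
  then have "\<bar>j - i\<bar> < 2" "\<bar>l - i\<bar> < 2" "\<bar>j - l\<bar> < 2"
    by linarith+
  moreover have "j \<noteq> i" "l \<noteq> i" using i S by auto
  ultimately show False using S(2) by arith
qed

theorem theorem1:
  fixes p \<gamma> \<epsilon> :: real
  assumes "0 < p" and "p < \<gamma>" and "\<gamma> < 1" and "\<epsilon> > 0"
  shows "((\<lambda>n. measure_pmf.prob (random_graph n p)
            {G. real (quasi_clique_number \<gamma> G) - quasi_clique_location \<gamma> p n
                  \<in> {-\<epsilon><..<1 + \<epsilon>}}) \<longlonglongrightarrow> 1)
       \<and> ((\<lambda>n. measure_pmf.prob (random_graph n p)
            {G. \<forall>S. two_closest_integers S (quasi_clique_location \<gamma> p n + 1 / 2)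
                  \<longrightarrow> int (quasi_clique_number \<gamma> G) \<in> S}) \<longlonglongrightarrow> 1)"
proof
  let ?P = "\<lambda>n. measure_pmf.prob (random_graph n p)"
  \<comment> \<open>The interval from -1/4 to 5/4 has midpoint 1/2 and radius 3/4, matching the
    distance required for membership in \<open>S\<close>.\<close>
  let ?near = "\<lambda>n. {G :: nat graph. real (quasi_clique_number \<gamma> G) - quasi_clique_location \<gamma> p n
    \<in> {- (1 / 4)<..<1 + 1 / 4}}"
  let ?X = "\<lambda>n. {G :: nat graph. \<forall>S. two_closest_integers S (quasi_clique_location \<gamma> p n + 1 / 2)
    \<longrightarrow> int (quasi_clique_number \<gamma> G) \<in> S}"
  have le: "?P n (?near n) \<le> ?P n (?X n)" for n
  proof (rule measure_pmf.finite_measure_mono)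
    show "?near n \<subseteq> ?X n"
    proof (intro subsetI CollectI allI impI)
      fix G :: "nat graph" and S
      assume G: "G \<in> ?near n"
        and S: "two_closest_integers S (quasi_clique_location \<gamma> p n + 1 / 2)"
      have "\<bar>of_int (int (quasi_clique_number \<gamma> G)) - (quasi_clique_location \<gamma> p n + 1 / 2)\<bar> < 3 / 4"
        using G unfolding mem_Collect_eq greaterThanLessThan_iff of_int_of_nat_eq by linarith
      with S show "int (quasi_clique_number \<gamma> G) \<in> S"
        by (rule two_closest_integers_mem)
    qed
  qed simp
  have near: "(\<lambda>n. ?P n (?near n)) \<longlonglongrightarrow> 1"
    using assms by (intro quasi_clique_number_concentration) auto
  show "(\<lambda>n. ?P n (?X n)) \<longlonglongrightarrow> 1"
    by (rule tendsto_sandwich[OF always_eventually always_eventually near tendsto_const])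
       (use le in auto)
qed (use assms in \<open>intro quasi_clique_number_concentration\<close>)

end
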